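(* Let $\mathcal{A}$ and $\mathcal{B}$ be $C^{*}$-algebras, let $\Xi$ be a Hilbert $\mathcal{A}$-module and $\nabla$ a Hilbert $\mathcal{B}$-module. Let $f:\Xi \rightarrow \nabla$ be a mapping for which there exists a function $\varphi:\Xi^{3}\rightarrow[0,\infty)$ such that $$\| f(\mu x+y)-\mu f(x)-f(y)\| \leq \varphi(x,y,0),$$ $$\| f(\langle x,y\rangle z)-\langle f(x),f(y)\rangle f(z)\| \leq \varphi(x,y,z),$$ $$\| f(\langle x,y\rangle^{*} z)-\langle f(x),f(y)\rangle^{*} f(z)\| \leq \varphi(x,y,z)$$ for all $x,y,z\in\Xi$ and all $\mu\in\mathbb{T}$. If there exists $0\leq L<1$ such that $\varphi(x,y,z)\leq 2L\,\varphi\left(\frac{x}{2},\frac{y}{2},\frac{z}{2}\right)$ for all $x,y,z\in\Xi$, then there exists a unique Hilbert $C^{*}$-module $\ast$-homomorphism $H:\Xi\rightarrow\nabla$ such that $$\|f(x)-H(x)\|\leq \frac{1}{2-2L}\varphi(x,x,0)$$ for all $x\in\Xi$.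
   Context: $\mathbb{T}=\{z\in\mathbb{C}:|z|=1\}$. For a $C^{*}$-algebra $\mathcal{A}$, a (left) Hilbert $\mathcal{A}$-module is a complex linear space $\Xi$ with a compatible left $\mathcal{A}$-module action ($\lambda(ax)=(\lambda a)x=a(\lambda x)$) and a map $\langle\cdot,\cdot\rangle:\Xi\times\Xi\to\mathcal{A}$ that is linear in the first variable, satisfies $\langle ax,y\rangle=a\langle x,y\rangle$, $\langle x,y\rangle^{*}=\langle y,x\rangle$, $\langle x,x\rangle\geq 0$ with equality iff $x=0$, and such that $\Xi$ is complete in the norm $\|x\|=\|\langle x,x\rangle\|^{1/2}$. For a Hilbert $\mathcal{A}$-module $\Xi$ and a Hilbert $\mathcal{B}$-module $\nabla$, a Hilbert $C^{*}$-module homomorphism is a $\mathbb{C}$-linear map $H:\Xi\to\nabla$ with $H(\langle x,y\rangle z)=\langle H(x),H(y)\rangle H(z)$ for all $x,y,z\in\Xi$; it is a Hilbert $C^{*}$-module $\ast$-homomorphism if moreover $H(\langle x,y\rangle^{*} z)=\langle H(x),H(y)\rangle^{*} H(z)$ for all $x,y,z\in\Xi$. *)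

theory Defs
  imports Complex_Main
begin

class complex_vector = real_vector +
  fixes scaleC :: "complex \<Rightarrow> 'a \<Rightarrow> 'a" (infixr \<open>*\<^sub>C\<close> 75)
  assumes scaleC_add_right: "c *\<^sub>C (x + y) = c *\<^sub>C x + c *\<^sub>C y"
    and scaleC_add_left: "(c + d) *\<^sub>C x = c *\<^sub>C x + d *\<^sub>C x"
    and scaleC_scaleC: "c *\<^sub>C (d *\<^sub>C x) = (c * d) *\<^sub>C x"
    and scaleC_one: "1 *\<^sub>C x = x"
    and scaleR_scaleC: "r *\<^sub>R x = complex_of_real r *\<^sub>C x"

class cstar_algebra = complex_vector + real_normed_algebra + banach +
  fixes cstar :: "'a \<Rightarrow> 'a"
  assumes norm_scaleC: "norm (c *\<^sub>C x) = cmod c * norm x"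
    and mult_scaleC_left: "(c *\<^sub>C x) * y = c *\<^sub>C (x * y)"
    and mult_scaleC_right: "x * (c *\<^sub>C y) = c *\<^sub>C (x * y)"
    and cstar_cstar: "cstar (cstar x) = x"
    and cstar_add: "cstar (x + y) = cstar x + cstar y"
    and cstar_scaleC: "cstar (c *\<^sub>C x) = cnj c *\<^sub>C cstar x"
    and cstar_mult: "cstar (x * y) = cstar y * cstar x"
    and cstar_identity: "norm (cstar x * x) = (norm x)\<^sup>2"

definition cstar_positive :: "'a::cstar_algebra \<Rightarrow> bool" where
  "cstar_positive a \<longleftrightarrow> (\<exists>b. a = cstar b * b)"

definition hnorm :: "('m \<Rightarrow> 'm \<Rightarrow> 'a::cstar_algebra) \<Rightarrow> 'm \<Rightarrow> real" where
  "hnorm ip x = sqrt (norm (ip x x))"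

definition hilbert_module ::
  "('a::cstar_algebra \<Rightarrow> 'm::complex_vector \<Rightarrow> 'm) \<Rightarrow> ('m \<Rightarrow> 'm \<Rightarrow> 'a) \<Rightarrow> bool" where
  "hilbert_module act ip \<longleftrightarrow>
     \<comment> \<open>left module action\<close>
     (\<forall>a x y. act a (x + y) = act a x + act a y) \<and>
     (\<forall>a b x. act (a + b) x = act a x + act b x) \<and>
     (\<forall>a b x. act (a * b) x = act a (act b x)) \<and>
     \<comment> \<open>compatibility with complex scalars\<close>
     (\<forall>c a x. c *\<^sub>C (act a x) = act (c *\<^sub>C a) x \<and> act a (c *\<^sub>C x) = c *\<^sub>C (act a x)) \<and>
     \<comment> \<open>inner product\<close>
     (\<forall>x y z. ip (x + y) z = ip x z + ip y z) \<and>
     (\<forall>c x y. ip (c *\<^sub>C x) y = c *\<^sub>C ip x y) \<and>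
     (\<forall>a x y. ip (act a x) y = a * ip x y) \<and>
     (\<forall>x y. cstar (ip x y) = ip y x) \<and>
     (\<forall>x. cstar_positive (ip x x)) \<and>
     (\<forall>x. ip x x = 0 \<longleftrightarrow> x = 0) \<and>
     \<comment> \<open>completeness w.r.t. the induced norm\<close>
     (\<forall>X::nat \<Rightarrow> 'm.
        (\<forall>e>0. \<exists>N. \<forall>m\<ge>N. \<forall>n\<ge>N. hnorm ip (X m - X n) < e) \<longrightarrow>
        (\<exists>l. (\<lambda>n. hnorm ip (X n - l)) \<longlonglongrightarrow> 0))"

definition hilbert_module_hom ::
  "('a::cstar_algebra \<Rightarrow> 'm::complex_vector \<Rightarrow> 'm) \<Rightarrow> ('m \<Rightarrow> 'm \<Rightarrow> 'a) \<Rightarrow>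
   ('b::cstar_algebra \<Rightarrow> 'n::complex_vector \<Rightarrow> 'n) \<Rightarrow> ('n \<Rightarrow> 'n \<Rightarrow> 'b) \<Rightarrow>
   ('m \<Rightarrow> 'n) \<Rightarrow> bool" where
  "hilbert_module_hom actA ipA actB ipB H \<longleftrightarrow>
     (\<forall>x y. H (x + y) = H x + H y) \<and>
     (\<forall>c x. H (c *\<^sub>C x) = c *\<^sub>C H x) \<and>
     (\<forall>x y z. H (actA (ipA x y) z) = actB (ipB (H x) (H y)) (H z))"

definition hilbert_module_star_hom ::
  "('a::cstar_algebra \<Rightarrow> 'm::complex_vector \<Rightarrow> 'm) \<Rightarrow> ('m \<Rightarrow> 'm \<Rightarrow> 'a) \<Rightarrow>
   ('b::cstar_algebra \<Rightarrow> 'n::complex_vector \<Rightarrow> 'n) \<Rightarrow> ('n \<Rightarrow> 'n \<Rightarrow> 'b) \<Rightarrow>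
   ('m \<Rightarrow> 'n) \<Rightarrow> bool" where
  "hilbert_module_star_hom actA ipA actB ipB H \<longleftrightarrow>
     hilbert_module_hom actA ipA actB ipB H \<and>
     (\<forall>x y z. H (actA (cstar (ipA x y)) z) = actB (cstar (ipB (H x) (H y))) (H z))"

end

theory Submission
  imports Defs "HOL-Analysis.Operator_Norm" "HOL-Computational_Algebra.Formal_Power_Series"
begin

text \<open>
  \<open>H x\<close> is the limit of \<open>f (2\<^sup>n x) / 2\<^sup>n\<close>; consecutive terms differ by at most \<open>L\<^sup>n \<phi>(x, x, 0) / 2\<close>. A map
  that is additive and homogeneous for unimodular scalars is complex linear because every complex
  number is a natural multiple of a sum of two unimodular ones. Multiplicativity follows by comparing
  the subsequence \<open>f (8\<^sup>n w) / 8\<^sup>n\<close> at \<open>w = \<langle>x, y\<rangle> z\<close> with \<open>\<langle>f (2\<^sup>n x), f (2\<^sup>n y)\<rangle> f (2\<^sup>n z) / 8\<^sup>n\<close>, and the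
  star version is multiplicativity with \<open>x\<close> and \<open>y\<close> exchanged.

  That the module norm satisfies the triangle inequality reduces to \<open>\<parallel>a\<parallel> \<le> \<parallel>a + b\<parallel>\<close> for elements
  \<open>a\<close>, \<open>b\<close> of the form \<open>c\<^sup>* c\<close> in a C*-algebra. This is proved in the unitization without spectral
  theory: positivity of a self-adjoint \<open>a\<close> is expressed as \<open>\<parallel>t - a\<parallel> \<le> t\<close> for some \<open>t\<close>, square roots come
  from the binomial series, and spectral comparisons are replaced by growth estimates for powers,
  using that \<open>\<parallel>h\<^sup>m\<parallel> = \<parallel>h\<parallel>\<^sup>m\<close> for self-adjoint \<open>h\<close> and \<open>m\<close> a power of two.
\<close>

section \<open>Positive elements of unital C*-algebras\<close>

lemma scaleC_zero_right [simp]: "c *\<^sub>C (0::'a::complex_vector) = 0"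
  using scaleC_add_right[of c 0 0] by simp

lemma scaleC_zero_left [simp]: "0 *\<^sub>C (x::'a::complex_vector) = 0"
  using scaleC_add_left[of 0 0 x] by simp

lemma scaleC_minus_right: "c *\<^sub>C (- x) = - (c *\<^sub>C (x::'a::complex_vector))"
  using scaleC_add_right[of c x "- x"] by (simp add: eq_neg_iff_add_eq_0 add.commute)

lemma scaleC_minus_left: "(- c) *\<^sub>C x = - (c *\<^sub>C (x::'a::complex_vector))"
  using scaleC_add_left[of c "- c" x] by (simp add: eq_neg_iff_add_eq_0 add.commute)

lemma scaleC_diff_right: "c *\<^sub>C (x - y) = c *\<^sub>C x - c *\<^sub>C (y::'a::complex_vector)"
  using scaleC_add_right[of c x "- y"] by (simp add: scaleC_minus_right)

lemma scaleC_scaleR: "c *\<^sub>C (r *\<^sub>R x) = r *\<^sub>R (c *\<^sub>C (x::'a::complex_vector))"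
  by (simp add: scaleR_scaleC scaleC_scaleC mult.commute)

lemma cstar_zero [simp]: "cstar (0::'a::cstar_algebra) = 0"
  using cstar_add[of "0::'a" 0] by simp

lemma cstar_minus: "cstar (- x) = - cstar (x::'a::cstar_algebra)"
  using cstar_add[of x "- x"] by (simp add: eq_neg_iff_add_eq_0 add.commute)

lemma cstar_diff: "cstar (x - y) = cstar x - cstar (y::'a::cstar_algebra)"
  using cstar_add[of x "- y"] by (simp add: cstar_minus)

lemma cstar_scaleR: "cstar (r *\<^sub>R x) = r *\<^sub>R cstar (x::'a::cstar_algebra)"
  by (simp add: scaleR_scaleC cstar_scaleC)

text \<open>The C*-identity and submultiplicativity give one inequality for every element; applying
  it to \<open>cstar x\<close> as well gives the other.\<close>

lemma norm_cstar [simp]: "norm (cstar x) = norm (x::'a::cstar_algebra)"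
proof -
  have le: "norm y \<le> norm (cstar y)" for y :: 'a
  proof (cases "y = 0")
    case False
    have "norm y * norm y \<le> norm (cstar y) * norm y"
      using cstar_identity[of y] norm_mult_ineq[of "cstar y" y] by (simp add: power2_eq_square)
    then show ?thesis using False by simp
  qed simp
  from le[of x] le[of "cstar x"] show ?thesis by (simp add: cstar_cstar)
qed

lemma bounded_linear_cstar: "bounded_linear (cstar :: 'a \<Rightarrow> 'a::cstar_algebra)"
  by (rule bounded_linear_intro[where K = 1]) (simp_all add: cstar_add cstar_scaleR)

lemma cstar_one [simp]: "cstar (1::'a::{cstar_algebra,real_normed_algebra_1}) = 1"
  using cstar_mult[of "cstar (1::'a)" 1] by (simp add: cstar_cstar)

lemma cstar_power: "cstar (x ^ n) = cstar (x::'a::{cstar_algebra,real_normed_algebra_1}) ^ n"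
  by (induction n) (simp_all add: cstar_mult power_commutes)

lemma norm_square_selfadjoint:
  "cstar h = h \<Longrightarrow> norm (h * h) = (norm (h::'a::cstar_algebra))\<^sup>2"
  using cstar_identity[of h] by simp

text \<open>By the C*-identity, squaring a self-adjoint element squares its norm, and powers stay
  self-adjoint. This replaces the spectral radius formula.\<close>

lemma norm_power_selfadjoint:
  fixes h :: "'a::{cstar_algebra,real_normed_algebra_1}"
  assumes "cstar h = h"
  shows "norm (h ^ (2 ^ k)) = norm h ^ (2 ^ k)"
proof (induction k)
  case (Suc k)
  have "norm (h ^ (2 ^ k) * h ^ (2 ^ k)) = (norm (h ^ (2 ^ k)))\<^sup>2"
    by (rule norm_square_selfadjoint) (simp add: cstar_power assms)
  then show ?case
    by (simp add: Suc power_add[symmetric] mult_2 power2_eq_square)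
qed simp

section \<open>The binomial series for the square root\<close>

lemma gbinomial_minus_half_sign: "(- 1) ^ n * ((- 1/2 :: real) gchoose n) \<ge> 0"
proof -
  have "(- 1/2 :: real) gchoose n = (- 1) ^ n * ((of_nat n - 1/2) gchoose n)"
    using gbinomial_negated_upper[of "- 1/2::real" n] by (simp add: algebra_simps)
  moreover have "((of_nat n - 1/2 :: real) gchoose n) \<ge> 0"
    by (auto simp: gbinomial_prod_rev intro!: divide_nonneg_nonneg prod_nonneg)
  ultimately show ?thesis by (simp flip: mult.assoc power_mult_distrib)
qed

text \<open>Absorption lowers the upper index to \<open>- 1/2\<close>. Hence in the expansion of
  \<open>sqrt (1 - x)\<close> every coefficient after the constant one is nonpositive.\<close>

lemma gbinomial_half_sign: "(- 1) ^ n * ((1/2 :: real) gchoose Suc n) \<ge> 0"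
proof -
  have "(1/2 :: real) gchoose Suc n = (1/2) / of_nat (Suc n) * ((- 1/2) gchoose n)"
    using gbinomial_absorption[of n "1/2::real"] by (simp add: field_simps)
  then have eq: "(- 1) ^ n * ((1/2 :: real) gchoose Suc n)
      = (1/2) / of_nat (Suc n) * ((- 1) ^ n * ((- 1/2 :: real) gchoose n))"
    by simp
  show ?thesis unfolding eq by (rule mult_nonneg_nonneg[OF _ gbinomial_minus_half_sign]) simp
qed

text \<open>Since the signs are known, the sum is \<open>1\<close> minus an alternating partial sum,
  whose closed form is nonnegative. Absolute convergence therefore reaches the boundary of the unit
  disc.\<close>

lemma sum_abs_gbinomial_half_le: "(\<Sum>n<m. \<bar>(1/2 :: real) gchoose Suc n\<bar>) \<le> 1"
proof -
  have "\<bar>(1/2 :: real) gchoose Suc n\<bar> = - ((- 1) ^ Suc n * ((1/2) gchoose Suc n))" for n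
    using gbinomial_half_sign[of n] by (simp add: abs_if power_minus1_even split: if_splits)
      (cases "even n"; simp)
  then have "(\<Sum>n<m. \<bar>(1/2 :: real) gchoose Suc n\<bar>)
      = 1 - (\<Sum>n\<le>m. (- 1) ^ n * ((1/2) gchoose n))"
    by (simp add: sum_negf sum.atMost_shift)
  also have "(\<Sum>n\<le>m. (- 1) ^ n * ((1/2::real) gchoose n)) = (- 1) ^ m * ((- 1/2) gchoose m)"
    using gbinomial_sum_lower_neg[of "1/2::real" m] by (simp add: mult.commute)
  finally show ?thesis using gbinomial_minus_half_sign[of m] by simp
qed

lemma sqrt_binomial_series:
  fixes x :: "'a::{real_normed_algebra_1,banach}"
  assumes "norm x \<le> 1"
  defines "S \<equiv> \<Sum>n. ((1/2) gchoose n) *\<^sub>R (- x) ^ n"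
  shows sqrt_binomial_summable: "summable (\<lambda>n. norm (((1/2) gchoose n) *\<^sub>R (- x) ^ n))"
    and sqrt_binomial_square: "S * S = 1 - x"
    and sqrt_binomial_norm: "norm (1 - S) \<le> 1"
proof -
  let ?c = "\<lambda>n. (1/2 :: real) gchoose n"
  have c_sum: "summable (\<lambda>n. \<bar>?c (Suc n)\<bar>)"
    by (rule summableI_nonneg_bounded[OF _ sum_abs_gbinomial_half_le]) simp
  have le: "norm (?c n *\<^sub>R (- x) ^ n) \<le> \<bar>?c n\<bar>" for n
    using norm_power_ineq[of "- x" n] power_le_one[OF norm_ge_zero assms(1), of n]
    by (simp add: mult_left_le)
  have "summable (\<lambda>n. \<bar>?c n\<bar>)" using c_sum summable_Suc_iff[of "\<lambda>n. \<bar>?c n\<bar>"] by simp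
  then show sm: "summable (\<lambda>n. norm (?c n *\<^sub>R (- x) ^ n))"
    by (rule summable_comparison_test') (use le in simp)
  \<comment> \<open>In the Cauchy product, Vandermonde adds the exponents 1/2 and 1/2 to 1, and the
    series for exponent 1 stops after its linear term.\<close>
  have "S * S = (\<Sum>k. \<Sum>i\<le>k. (?c i *\<^sub>R (- x) ^ i) * (?c (k - i) *\<^sub>R (- x) ^ (k - i)))"
    unfolding S_def by (rule Cauchy_product[OF sm sm])
  also have "(\<lambda>k. \<Sum>i\<le>k. (?c i *\<^sub>R (- x) ^ i) * (?c (k - i) *\<^sub>R (- x) ^ (k - i)))
      = (\<lambda>k. (1 gchoose k) *\<^sub>R (- x) ^ k)"
  proof
    fix k
    have "(\<Sum>i\<le>k. (?c i *\<^sub>R (- x) ^ i) * (?c (k - i) *\<^sub>R (- x) ^ (k - i)))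
      = (\<Sum>i\<le>k. (?c i * ?c (k - i)) *\<^sub>R (- x) ^ k)"
      by (intro sum.cong) (auto simp: power_add[symmetric])
    also have "\<dots> = (1 gchoose k) *\<^sub>R (- x) ^ k"
      using gbinomial_Vandermonde[of "1/2::real" "1/2" k]
      by (simp add: scaleR_sum_left[symmetric] atMost_atLeast0)
    finally show "(\<Sum>i\<le>k. (?c i *\<^sub>R (- x) ^ i) * (?c (k - i) *\<^sub>R (- x) ^ (k - i)))
      = (1 gchoose k) *\<^sub>R (- x) ^ k" .
  qed
  also have "(\<Sum>k. (1 gchoose k) *\<^sub>R (- x) ^ k) = (\<Sum>k\<in>{0,1}. (1 gchoose k) *\<^sub>R (- x) ^ k)"
  proof (rule suminf_finite)
    fix k :: nat assume "k \<notin> {0, 1}"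
    then have "(1::nat) choose k = 0" by (intro binomial_eq_0) auto
    moreover have "(1::real) gchoose k = of_nat (1 choose k)"
      using binomial_gbinomial[of 1 k, where ?'a = real] by simp
    ultimately show "((1::real) gchoose k) *\<^sub>R (- x) ^ k = 0" by simp
  qed simp
  also have "\<dots> = 1 - x" by simp
  finally show "S * S = 1 - x" .
  have "S = 1 + (\<Sum>n. ?c (Suc n) *\<^sub>R (- x) ^ Suc n)"
    unfolding S_def using suminf_split_head[OF summable_norm_cancel[OF sm]] by simp
  then have "norm (1 - S) = norm (\<Sum>n. ?c (Suc n) *\<^sub>R (- x) ^ Suc n)"
    by (simp add: norm_minus_commute)
  also have "\<dots> \<le> (\<Sum>n. norm (?c (Suc n) *\<^sub>R (- x) ^ Suc n))"
    by (rule summable_norm) (use sm summable_Suc_iff[of "\<lambda>n. norm (?c n *\<^sub>R (- x) ^ n)"] in simp)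
  also have "\<dots> \<le> (\<Sum>n. \<bar>?c (Suc n)\<bar>)"
    by (rule suminf_le[OF le _ c_sum])
      (use sm summable_Suc_iff[of "\<lambda>n. norm (?c n *\<^sub>R (- x) ^ n)"] in simp)
  also have "\<dots> \<le> 1"
    by (rule suminf_le_const[OF c_sum sum_abs_gbinomial_half_le])
  finally show "norm (1 - S) \<le> 1" .
qed

text \<open>The existential quantifier over \<open>t\<close> makes closure under sums immediate; that every
  \<open>t \<ge> norm a\<close> works is a theorem (\<open>norm_diff_square_le\<close>).\<close>
definition psd :: "'a::{cstar_algebra,real_normed_algebra_1} \<Rightarrow> bool" where
  "psd a \<longleftrightarrow> cstar a = a \<and> (\<exists>t\<ge>0. norm (t *\<^sub>R 1 - a) \<le> t)"

lemma psd_selfadjoint: "psd a \<Longrightarrow> cstar a = a"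
  by (simp add: psd_def)

lemma psdI: "cstar a = a \<Longrightarrow> norm (t *\<^sub>R 1 - a) \<le> t \<Longrightarrow> psd a"
  unfolding psd_def using norm_ge_zero order_trans by blast

lemma psd_add:
  assumes "psd a" "psd b" shows "psd (a + b)"
proof -
  obtain s t where "norm (s *\<^sub>R 1 - a) \<le> s" "norm (t *\<^sub>R 1 - b) \<le> t"
    using assms unfolding psd_def by blast
  then have "norm ((s + t) *\<^sub>R 1 - (a + b)) \<le> s + t"
    using norm_triangle_ineq[of "s *\<^sub>R 1 - a" "t *\<^sub>R 1 - b"] by (simp add: algebra_simps)
  then show ?thesis
    using assms by (intro psdI) (auto simp: cstar_add psd_selfadjoint)
qed

lemma psd_scaleR:
  assumes "psd a" "0 \<le> r" shows "psd (r *\<^sub>R a)"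
proof -
  obtain t where t: "norm (t *\<^sub>R 1 - a) \<le> t"
    using assms unfolding psd_def by blast
  have "norm ((r * t) *\<^sub>R 1 - r *\<^sub>R a) = norm (r *\<^sub>R (t *\<^sub>R 1 - a))"
    by (simp add: algebra_simps)
  also have "\<dots> \<le> r * t"
    using t assms(2) by (simp add: mult_left_mono)
  finally show ?thesis
    using assms by (intro psdI) (auto simp: cstar_scaleR psd_selfadjoint)
qed

text \<open>The root is \<open>sqrt t\<close> times the binomial series at \<open>1 - a / t\<close>,
  an element of norm at most 1. As a limit of polynomials in \<open>a\<close> it commutes with all
  that commutes with \<open>a\<close>; later this makes roots of different elements commute.\<close>

lemma psd_sqrt_exists:
  fixes a :: "'a::{cstar_algebra,real_normed_algebra_1}"
  assumes "psd a"
  obtains s where "psd s" "s * s = a" "\<And>z. a * z = z * a \<Longrightarrow> s * z = z * s"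
proof -
  obtain t where sa: "cstar a = a" and t: "0 \<le> t" "norm (t *\<^sub>R 1 - a) \<le> t"
    using assms unfolding psd_def by blast
  show thesis
  proof (cases "t = 0")
    case True
    then have "a = 0" using t by simp
    then show thesis using assms by (intro that[of 0]) auto
  next
    case False
    define x where "x = 1 - (1 / t) *\<^sub>R a"
    have "norm x = norm ((1 / t) *\<^sub>R (t *\<^sub>R 1 - a))"
      using False by (simp add: x_def algebra_simps)
    also have "\<dots> \<le> 1" unfolding norm_scaleR using t False by (simp add: field_simps)
    finally have x: "norm x \<le> 1" .
    define S where "S = (\<Sum>n. ((1/2) gchoose n) *\<^sub>R (- x) ^ n)"
    have sm: "summable (\<lambda>n. ((1/2) gchoose n) *\<^sub>R (- x) ^ n)"
      using sqrt_binomial_summable[OF x] by (rule summable_norm_cancel)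
    have cx: "cstar (- x) = - x"
      using sa by (simp add: x_def cstar_diff cstar_minus cstar_scaleR)
    have "cstar S = (\<Sum>n. cstar (((1/2) gchoose n) *\<^sub>R (- x) ^ n))"
      unfolding S_def by (rule bounded_linear.suminf[OF bounded_linear_cstar sm])
    then have cS: "cstar S = S" by (simp add: cstar_scaleR cstar_power cx S_def)
    have comm: "S * z = z * S" if "a * z = z * a" for z
    proof -
      have "(- x) * z = z * (- x)" using that by (simp add: x_def algebra_simps)
      then have pw: "(- x) ^ n * z = z * (- x) ^ n" for n
        by (rule power_commuting_commutes)
      have "S * z = (\<Sum>n. (((1/2) gchoose n) *\<^sub>R (- x) ^ n) * z)"
        unfolding S_def by (rule suminf_mult2[OF sm])
      also have "\<dots> = (\<Sum>n. z * (((1/2) gchoose n) *\<^sub>R (- x) ^ n))"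
        by (simp add: pw)
      also have "\<dots> = z * S"
        unfolding S_def by (rule suminf_mult[OF sm])
      finally show ?thesis .
    qed
    have "psd S"
      using cS sqrt_binomial_norm[OF x] by (intro psdI[of _ 1]) (simp_all add: S_def)
    then have "psd (sqrt t *\<^sub>R S)" by (rule psd_scaleR) (use t in simp)
    moreover have "(sqrt t *\<^sub>R S) * (sqrt t *\<^sub>R S) = a"
      using sqrt_binomial_square[OF x, folded S_def] t False by (simp add: x_def)
    moreover have "(sqrt t *\<^sub>R S) * z = z * (sqrt t *\<^sub>R S)" if "a * z = z * a" for z
      using comm[OF that] by simp
    ultimately show thesis by (rule that)
  qed
qed

text \<open>\<open>p + \<i> w\<close> is \<open>sqrt r\<close> times a unitary.\<close>
lemma norm_square_le_of_square_sum:
  fixes p w :: "'a::{cstar_algebra,real_normed_algebra_1}"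
  assumes "cstar p = p" "cstar w = w" "p * w = w * p" "p * p + w * w = r *\<^sub>R 1" "0 \<le> r"
  shows "norm (p * p) \<le> r"
proof -
  define u where "u = p + \<i> *\<^sub>C w"
  have cu: "cstar u = p - \<i> *\<^sub>C w"
    using assms(1,2) by (simp add: u_def cstar_add cstar_scaleC scaleC_minus_left)
  have "(p - \<i> *\<^sub>C w) * (p + \<i> *\<^sub>C w) = p * p + w * w"
    using assms(3)
    by (simp add: algebra_simps mult_scaleC_left mult_scaleC_right scaleC_scaleC
        scaleC_minus_left scaleC_one scaleC_diff_right)
  then have "cstar u * u = r *\<^sub>R 1"
    by (simp only: cu) (simp only: u_def assms(4))
  then have "(norm u)\<^sup>2 = r" using cstar_identity[of u] assms(5) by simp
  moreover have "u + cstar u = 2 *\<^sub>R p"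
    by (simp only: cu) (simp add: u_def scaleR_2)
  then have "norm p \<le> norm u" using norm_triangle_ineq[of u "cstar u"] by simp
  then have "(norm p)\<^sup>2 \<le> (norm u)\<^sup>2" by (intro power_mono) auto
  ultimately show ?thesis using norm_square_selfadjoint[OF assms(1)] by simp
qed

text \<open>If \<open>w\<close> is the root of \<open>t - s * s\<close>, then \<open>w\<close> and
  \<open>s\<close> commute and their squares sum to \<open>t\<close>, so
  \<open>norm_square_le_of_square_sum\<close> bounds \<open>w * w\<close>.\<close>

lemma norm_diff_square_le:
  fixes s :: "'a::{cstar_algebra,real_normed_algebra_1}"
  assumes "cstar s = s" "norm (s * s) \<le> t"
  shows "norm (t *\<^sub>R 1 - s * s) \<le> t"
proof -
  have t: "0 \<le> t" using assms(2) norm_ge_zero order_trans by blast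
  \<comment> \<open>The witness is \<open>t\<close> itself: subtracting the element from
    \<open>t\<close> leaves \<open>s * s\<close>.\<close>
  have "psd (t *\<^sub>R 1 - s * s)"
    using assms by (intro psdI[of _ t]) (simp_all add: cstar_diff cstar_scaleR cstar_mult)
  then obtain w where w: "psd w" "w * w = t *\<^sub>R 1 - s * s"
    and comm: "\<And>z. (t *\<^sub>R 1 - s * s) * z = z * (t *\<^sub>R 1 - s * s) \<Longrightarrow> w * z = z * w"
    using psd_sqrt_exists by blast
  have "w * s = s * w" by (rule comm) (simp add: algebra_simps)
  then have "norm (w * w) \<le> t"
    using w assms(1) t by (intro norm_square_le_of_square_sum[of w s]) (auto simp: psd_selfadjoint)
  then show ?thesis by (simp add: w)
qed

lemma psd_square: "cstar s = s \<Longrightarrow> psd (s * s)"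
  by (rule psdI[OF _ norm_diff_square_le]) (auto simp: cstar_mult)

text \<open>The roots \<open>p\<close> of \<open>a\<close> and \<open>w\<close> of
  \<open>r - a\<close> commute, and their squares sum to \<open>r\<close>.\<close>

lemma psd_norm_le:
  assumes "psd a" "psd (r *\<^sub>R 1 - a)" "0 \<le> r"
  shows "norm a \<le> r"
proof -
  obtain p where p: "psd p" "p * p = a" using psd_sqrt_exists[OF assms(1)] by blast
  obtain w where w: "psd w" "w * w = r *\<^sub>R 1 - a"
    and comm: "\<And>z. (r *\<^sub>R 1 - a) * z = z * (r *\<^sub>R 1 - a) \<Longrightarrow> w * z = z * w"
    using psd_sqrt_exists[OF assms(2)] by blast
  have "a * p = p * a" unfolding p(2)[symmetric] by (simp add: mult.assoc)
  then have "w * p = p * w" by (intro comm) (simp add: algebra_simps)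
  then have "norm (p * p) \<le> r"
    using p w assms(3) by (intro norm_square_le_of_square_sum[of p w]) (auto simp: psd_selfadjoint)
  then show ?thesis by (simp add: p)
qed

section \<open>Growth of powers in place of spectral comparison\<close>

lemma le_of_power_le_linear_growth:
  fixes q t C :: real
  assumes "0 \<le> t" "\<And>k. q ^ (2 ^ k) \<le> t ^ (2 ^ k) + 2 ^ k * (C * t ^ (2 ^ k - 1))"
  shows "q \<le> t"
proof (rule ccontr)
  assume "\<not> q \<le> t"
  then have qt: "t < q" by simp
  show False
  proof (cases "t = 0")
    case True
    \<comment> \<open>For \<open>k = 1\<close> the right side is zero; \<open>k = 0\<close> would
      leave \<open>C * 0 ^ 0 = C\<close>.\<close>
    then show False using assms(2)[of 1] qt by (simp add: not_le[symmetric] power_le_zero_eq)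
  next
    case False
    then have t: "0 < t" using assms(1) by simp
    \<comment> \<open>After division by \<open>t ^ m\<close>, with \<open>m = 2 ^ k\<close>, the
      exponential \<open>d ^ m\<close> would be bounded by a linear function of
      \<open>m\<close>.\<close>
    define d where "d = q / t"
    have d: "1 < d" using t qt by (simp add: d_def)
    have bound: "d ^ (2 ^ k) \<le> 1 + C / t * 2 ^ k" for k
    proof -
      have "t ^ (2 ^ k) = t * t ^ (2 ^ k - 1)"
        by (simp flip: power_Suc)
      then show ?thesis
        using assms(2)[of k] t by (simp add: d_def power_divide field_simps)
    qed
    have lim1: "(\<lambda>n. of_nat n * (1 / d) ^ n) \<longlonglongrightarrow> 0"
      by (rule powser_times_n_limit_0) (use d in simp)
    have lim2: "(\<lambda>n. (1 / d) ^ n) \<longlonglongrightarrow> 0"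
      by (rule LIMSEQ_realpow_zero) (use d in simp_all)
    have "(\<lambda>n. (1 / d) ^ n + C / t * (of_nat n * (1 / d) ^ n)) \<longlonglongrightarrow> 0 + C / t * 0"
      by (rule tendsto_add[OF lim2 tendsto_mult[OF tendsto_const lim1]])
    then have "(\<lambda>k. (1 / d) ^ (2 ^ k) + C / t * (of_nat (2 ^ k) * (1 / d) ^ (2 ^ k))) \<longlonglongrightarrow> 0"
      using LIMSEQ_subseq_LIMSEQ[of _ _ "\<lambda>k. 2 ^ k :: nat"] by (force simp: strict_mono_def o_def)
    moreover have "1 \<le> (1 / d) ^ (2 ^ k) + C / t * (of_nat (2 ^ k) * (1 / d) ^ (2 ^ k))" for k
      using bound[of k] d by (simp add: power_divide field_simps)
    ultimately have "(1::real) \<le> 0"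
      by (intro LIMSEQ_le_const) auto
    then show False by simp
  qed
qed

text \<open>Since \<open>(t - y)\<^sup>m = t\<^sup>m - (\<Sum>j<m. t\<^bsup>m-1-j\<^esup> y (t - y)\<^sup>j)\<close>, the hypothesis makes the powers of
  \<open>t - y\<close> grow like \<open>m t\<^sup>m\<close>, and for self-adjoint elements the norm is the spectral radius.\<close>
lemma norm_diff_le_of_power_bound:
  fixes y :: "'a::{cstar_algebra,real_normed_algebra_1}"
  assumes "cstar y = y" "0 \<le> t" "\<And>j. norm (y * (t *\<^sub>R 1 - y) ^ j) \<le> C * t ^ j"
  shows "norm (t *\<^sub>R 1 - y) \<le> t"
proof -
  let ?x = "t *\<^sub>R 1 - y"
  have bound: "norm (?x ^ m) \<le> t ^ m + real m * (C * t ^ (m - 1))" for m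
  proof (induction m)
    case (Suc m)
    have "norm (?x ^ Suc m) = norm (t *\<^sub>R ?x ^ m - y * ?x ^ m)"
      by (simp add: algebra_simps)
    also have "\<dots> \<le> t * norm (?x ^ m) + norm (y * ?x ^ m)"
      using norm_triangle_ineq4[of "t *\<^sub>R ?x ^ m" "y * ?x ^ m"] assms(2) by simp
    also have "\<dots> \<le> t * (t ^ m + real m * (C * t ^ (m - 1))) + C * t ^ m"
      using Suc assms(2,3) by (intro add_mono mult_left_mono) auto
    also have "\<dots> = t ^ Suc m + real (Suc m) * (C * t ^ (Suc m - 1))"
      by (cases m) (simp_all add: algebra_simps)
    finally show ?case .
  qed simp
  have "cstar ?x = ?x" using assms(1) by (simp add: cstar_diff cstar_scaleR)
  then have "norm ?x ^ (2 ^ k) \<le> t ^ (2 ^ k) + 2 ^ k * (C * t ^ (2 ^ k - 1))" for k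
    using bound[of "2 ^ k"] by (simp add: norm_power_selfadjoint)
  then show ?thesis by (rule le_of_power_le_linear_growth[OF assms(2)])
qed

text \<open>The nonzero spectra of the two products agree. In place of this, the relation
  \<open>d * (t - cstar d * d) = (t - d * cstar d) * d\<close> expresses the powers of one
  difference by those of the other, which are bounded by \<open>t ^ j\<close>.\<close>

lemma psd_swap:
  assumes "psd (d * cstar d)" shows "psd (cstar d * d)"
proof -
  obtain t where t: "0 \<le> t" "norm (t *\<^sub>R 1 - d * cstar d) \<le> t"
    using assms unfolding psd_def by blast
  have eq: "(cstar d * d) * (t *\<^sub>R 1 - cstar d * d) ^ j = cstar d * (t *\<^sub>R 1 - d * cstar d) ^ j * d" for j
  proof (induction j)
    case (Suc j)
    have "(cstar d * d) * (t *\<^sub>R 1 - cstar d * d) ^ Suc j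
        = ((cstar d * d) * (t *\<^sub>R 1 - cstar d * d) ^ j) * (t *\<^sub>R 1 - cstar d * d)"
      by (simp only: power_Suc2 mult.assoc)
    also have "\<dots> = cstar d * (t *\<^sub>R 1 - d * cstar d) ^ j * (d * (t *\<^sub>R 1 - cstar d * d))"
      by (subst Suc) (simp only: mult.assoc)
    also have "d * (t *\<^sub>R 1 - cstar d * d) = (t *\<^sub>R 1 - d * cstar d) * d"
      by (simp add: algebra_simps)
    finally show ?case by (simp only: power_Suc2 mult.assoc)
  qed simp
  have "norm ((cstar d * d) * (t *\<^sub>R 1 - cstar d * d) ^ j) \<le> (norm d * norm d) * t ^ j" for j
  proof -
    have "norm (cstar d * (t *\<^sub>R 1 - d * cstar d) ^ j * d)
        \<le> norm (cstar d) * norm ((t *\<^sub>R 1 - d * cstar d) ^ j) * norm d"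
      by (meson norm_mult_ineq order_trans mult_right_mono norm_ge_zero)
    also have "\<dots> \<le> norm d * t ^ j * norm d"
      using norm_power_ineq[of "t *\<^sub>R 1 - d * cstar d" j] power_mono[OF t(2), of j]
      by (intro mult_right_mono) (auto intro!: mult_left_mono)
    finally show ?thesis unfolding eq by (simp only: mult_ac)
  qed
  then show ?thesis
    by (intro psdI[OF _ norm_diff_le_of_power_bound[OF _ t(1)]]) (auto simp: cstar_mult cstar_cstar)
qed

text \<open>Multiplication by \<open>n\<close> hides \<open>p\<close>: after it, powers of
  \<open>t - n\<close> may be replaced by powers of \<open>t - (p + n)\<close>, whose norms are at
  most \<open>t ^ j\<close>.\<close>

lemma psd_summand_of_annihilating:
  assumes "psd (p + n)" "cstar n = n" "n * p = 0"
  shows "psd n"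
proof -
  obtain t where t: "0 \<le> t" "norm (t *\<^sub>R 1 - (p + n)) \<le> t"
    using assms(1) unfolding psd_def by blast
  have eq: "n * (t *\<^sub>R 1 - n) ^ j = n * (t *\<^sub>R 1 - (p + n)) ^ j" for j
  proof (induction j)
    case (Suc j)
    have "n * (t *\<^sub>R 1 - n) ^ Suc j = (t *\<^sub>R 1 - n) * (n * (t *\<^sub>R 1 - n) ^ j)"
      by (simp add: algebra_simps)
    also have "\<dots> = ((t *\<^sub>R 1 - n) * n) * (t *\<^sub>R 1 - (p + n)) ^ j"
      by (simp only: Suc mult.assoc)
    also have "(t *\<^sub>R 1 - n) * n = n * (t *\<^sub>R 1 - (p + n))"
      using assms(3) by (simp add: algebra_simps)
    finally show ?case by (simp only: power_Suc mult.assoc)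
  qed simp
  have "norm (n * (t *\<^sub>R 1 - n) ^ j) \<le> norm n * t ^ j" for j
    unfolding eq
    using norm_mult_ineq[of n "(t *\<^sub>R 1 - (p + n)) ^ j"]
      norm_power_ineq[of "t *\<^sub>R 1 - (p + n)" j] power_mono[OF t(2), of j]
    by (meson mult_left_mono norm_ge_zero order_trans)
  then show ?thesis
    by (intro psdI[OF _ norm_diff_le_of_power_bound[OF _ t(1)]]) (auto simp: assms(2))
qed

text \<open>Kaplansky's argument: if \<open>n\<close> is (twice) the negative part of \<open>b\<^sup>* b\<close>, then \<open>d = b n\<close> satisfies
  \<open>2 d\<^sup>* d = - n\<^sup>3\<close>, while \<open>d d\<^sup>* + d\<^sup>* d\<close> is a sum of squares; so \<open>d d\<^sup>*\<close> is positive and, by swapping,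
  so is \<open>- n\<^sup>3\<close>.\<close>
theorem psd_cstar_mult_self: "psd (cstar b * b)"
proof -
  define h where "h = cstar b * b"
  have ch: "cstar h = h" by (simp add: h_def cstar_mult cstar_cstar)
  \<comment> \<open>\<open>a\<close> is the absolute value of \<open>h\<close>, so \<open>p\<close>
    and \<open>n\<close> are twice the positive and negative parts of \<open>h\<close>; their
    product vanishes because \<open>a\<close> commutes with \<open>h\<close>.\<close>
  obtain a where a: "psd a" "a * a = h * h"
    and comm: "\<And>z. (h * h) * z = z * (h * h) \<Longrightarrow> a * z = z * a"
    using psd_sqrt_exists[OF psd_square[OF ch]] by blast
  have ah: "a * h = h * a" by (rule comm) (simp add: mult.assoc)
  define p n where "p = a + h" and "n = a - h"
  have np: "n * p = 0"
    using a(2) ah by (simp add: p_def n_def algebra_simps)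
  have cn: "cstar n = n" using a(1) ch by (simp add: n_def cstar_diff psd_selfadjoint)
  have "psd (p + n)" using psd_scaleR[OF a(1), of 2] by (simp add: p_def n_def scaleR_2)
  then have pn: "psd n" using cn np by (rule psd_summand_of_annihilating)
  obtain q where q: "psd q" "q * q = n" using psd_sqrt_exists[OF pn] by blast
  have n3: "n * n * n = (q * q * q) * (q * q * q)" by (simp add: q(2)[symmetric] mult.assoc)
  have cq: "cstar (q * q * q) = q * q * q"
    using q(1) by (simp add: cstar_mult psd_selfadjoint mult.assoc)
  have pn3: "psd (n * n * n)" unfolding n3 by (rule psd_square[OF cq])
  define d where "d = b * n"
  have "p - n = 2 *\<^sub>R h" by (simp add: p_def n_def scaleR_2)
  then have "n * (2 *\<^sub>R h) * n = n * p * n - n * n * n" by (metis left_diff_distrib right_diff_distrib)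
  moreover have "cstar d * d = n * h * n" by (simp add: d_def h_def cstar_mult cn mult.assoc)
  ultimately have dd: "2 *\<^sub>R (cstar d * d) = - (n * n * n)" using np by simp
  \<comment> \<open>Up to sign, twice the real and imaginary parts of \<open>d\<close>; in
    \<open>U * U + V * V\<close> the terms \<open>d * d\<close> and \<open>cstar d * cstar d\<close>
    cancel.\<close>
  define U V where "U = d + cstar d" and "V = \<i> *\<^sub>C (d - cstar d)"
  have "U * U = d * d + cstar d * cstar d + (d * cstar d + cstar d * d)"
    by (simp add: U_def algebra_simps)
  moreover have "V * V = - ((d - cstar d) * (d - cstar d))"
    by (simp add: V_def mult_scaleC_left mult_scaleC_right scaleC_scaleC scaleC_minus_left scaleC_one)
  moreover have "(d - cstar d) * (d - cstar d)
      = d * d + cstar d * cstar d - (d * cstar d + cstar d * d)"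
    by (simp add: algebra_simps)
  ultimately have "U * U + V * V + n * n * n = 2 *\<^sub>R (d * cstar d) + 2 *\<^sub>R (cstar d * d) + n * n * n"
    by (simp add: scaleR_2)
  then have "2 *\<^sub>R (d * cstar d) = U * U + V * V + n * n * n"
    by (simp add: dd)
  moreover have "psd (U * U)" "psd (V * V)"
    by (intro psd_square; simp add: U_def V_def cstar_add cstar_scaleC cstar_diff cstar_cstar
        add.commute scaleC_minus_left scaleC_diff_right)+
  ultimately have "psd (2 *\<^sub>R (d * cstar d))" using pn3 by (simp add: psd_add)
  then have "psd (d * cstar d)" using psd_scaleR[of "2 *\<^sub>R (d * cstar d)" "1/2"] by simp
  then have "psd (2 *\<^sub>R (cstar d * d))" by (intro psd_scaleR psd_swap) auto
  \<comment> \<open>Both \<open>n * n * n\<close> and its negative are positive, so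
    \<open>psd_norm_le\<close> applies with \<open>r = 0\<close>.\<close>
  then have "norm (n * n * n) \<le> 0" using pn3 by (intro psd_norm_le) (auto simp: dd)
  \<comment> \<open>The fourth power is taken because \<open>norm_power_selfadjoint\<close> covers
    exponents \<open>2 ^ k\<close>.\<close>
  then have "n ^ (2 ^ 2) = 0" by (simp add: numeral_eq_Suc mult.assoc)
  then have "n = 0" using norm_power_selfadjoint[OF cn, of 2] by simp
  then have "a = h" by (simp add: n_def)
  then show ?thesis using a(1) by (simp add: h_def)
qed

section \<open>Monotonicity of the norm on positive elements\<close>

lemma psd_norm_diff: "cstar c = c \<Longrightarrow> psd (norm c *\<^sub>R 1 - c)"
  by (rule psdI[of _ "norm c"]) (simp_all add: cstar_diff cstar_scaleR)

text \<open>\<open>norm (a + b) - a\<close> is the sum of the positive elements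
  \<open>norm (a + b) - (a + b)\<close> and \<open>b\<close>.\<close>

lemma norm_psd_mono:
  assumes "psd a" "psd b"
  shows "norm a \<le> norm (a + b)"
proof -
  have "psd (norm (a + b) *\<^sub>R 1 - (a + b))"
    using assms by (intro psd_norm_diff) (simp add: cstar_add psd_selfadjoint)
  then have "psd ((norm (a + b) *\<^sub>R 1 - (a + b)) + b)" by (rule psd_add[OF _ assms(2)])
  moreover have "(norm (a + b) *\<^sub>R 1 - (a + b)) + b = norm (a + b) *\<^sub>R 1 - a"
    by (simp add: algebra_simps)
  ultimately show ?thesis using assms(1) by (intro psd_norm_le) auto
qed

section \<open>Unitization\<close>

datatype 'a unitization = Unitization (uscal: complex) (uelem: 'a)

text \<open>The left regular representation of the unitization on the original algebra; its operator
  norm enters the norm of the unitization.\<close>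

definition uop :: "'a::cstar_algebra unitization \<Rightarrow> 'a \<Rightarrow> 'a" where
  "uop x v = uscal x *\<^sub>C v + uelem x * v"

lemma bounded_linear_uop: "bounded_linear (uop x)"
proof (rule bounded_linear_intro[where K = "cmod (uscal x) + norm (uelem x)"])
  show "norm (uop x v) \<le> norm v * (cmod (uscal x) + norm (uelem x))" for v
    using norm_triangle_ineq[of "uscal x *\<^sub>C v" "uelem x * v"] norm_mult_ineq[of "uelem x" v]
    by (simp add: uop_def norm_scaleC algebra_simps)
qed (simp_all add: uop_def scaleC_add_right scaleC_scaleR algebra_simps)

instantiation unitization :: (cstar_algebra) real_algebra_1
begin

definition "0 = Unitization 0 0"
definition "1 = Unitization 1 0"
definition "x + y = Unitization (uscal x + uscal y) (uelem x + uelem y)"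
definition "x - y = Unitization (uscal x - uscal y) (uelem x - uelem y)"
definition "- x = Unitization (- uscal x) (- uelem x)"
definition "r *\<^sub>R x = Unitization (r *\<^sub>R uscal x) (r *\<^sub>R uelem x)"
definition "x * y = Unitization (uscal x * uscal y)
  (uscal x *\<^sub>C uelem y + uscal y *\<^sub>C uelem x + uelem x * uelem y)"

lemmas unitization_defs = zero_unitization_def one_unitization_def plus_unitization_def
  minus_unitization_def uminus_unitization_def scaleR_unitization_def times_unitization_def

instance
  by standard (simp_all add: unitization_defs unitization.expand scaleC_add_left scaleC_add_right
      scaleC_scaleC mult_scaleC_left mult_scaleC_right scaleC_one
      scaleR_scaleC scaleR_conv_of_real algebra_simps)

end

instantiation unitization :: (cstar_algebra) complex_vector
begin

definition "c *\<^sub>C x = Unitization (c * uscal x) (c *\<^sub>C uelem x)"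

instance
  by standard (simp_all add: unitization_defs scaleC_unitization_def scaleC_add_left scaleC_add_right
      scaleC_scaleC scaleC_one scaleR_conv_of_real scaleR_scaleC algebra_simps)

end

lemma uop_add: "uop (x + y) = (\<lambda>v. uop x v + uop y v)"
  by (simp add: fun_eq_iff uop_def unitization_defs scaleC_add_left algebra_simps)

lemma uop_scaleC: "uop (c *\<^sub>C x) = (\<lambda>v. c *\<^sub>C uop x v)"
  by (simp add: fun_eq_iff uop_def scaleC_unitization_def scaleC_add_right scaleC_scaleC mult_scaleC_left)

lemma uop_mult: "uop (x * y) = uop x \<circ> uop y"
  by (simp add: fun_eq_iff uop_def unitization_defs scaleC_add_left scaleC_add_right scaleC_scaleC
      mult_scaleC_left mult_scaleC_right algebra_simps)

lemma onorm_uop_scaleC: "onorm (uop (c *\<^sub>C x)) = cmod c * onorm (uop x)"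
proof -
  have le: "onorm (uop (c *\<^sub>C x)) \<le> cmod c * onorm (uop x)" for c and x :: "'a unitization"
    using onorm[OF bounded_linear_uop, of x]
    by (intro onorm_bound) (auto simp: uop_scaleC norm_scaleC mult.assoc onorm_pos_le[OF bounded_linear_uop]
        intro!: mult_left_mono)
  show ?thesis
  proof (cases "c = 0")
    case True
    then show ?thesis using le[of c x] onorm_pos_le[OF bounded_linear_uop, of "c *\<^sub>C x"] by simp
  next
    case False
    then have "onorm (uop x) \<le> cmod (1 / c) * onorm (uop (c *\<^sub>C x))"
      using le[of "1 / c" "c *\<^sub>C x"] by (simp add: scaleC_scaleC scaleC_one)
    then show ?thesis using le[of c x] False by (simp add: norm_divide field_simps)
  qed
qed

text \<open>By the C*-identity, the test vector \<open>cstar a\<close> attains the bound. This makes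
  the embedding into the unitization isometric.\<close>

lemma onorm_uop_elem: "onorm (uop (Unitization 0 a)) = norm (a::'a::cstar_algebra)"
proof (rule antisym)
  show "onorm (uop (Unitization 0 a)) \<le> norm a"
    by (intro onorm_bound) (auto simp: uop_def norm_mult_ineq)
  have "norm a * norm a \<le> onorm (uop (Unitization 0 a)) * norm a"
    using onorm[OF bounded_linear_uop, of "Unitization 0 a" "cstar a"] cstar_identity[of "cstar a"]
    by (simp add: uop_def cstar_cstar power2_eq_square)
  then show "norm a \<le> onorm (uop (Unitization 0 a))"
    by (cases "a = 0") (auto simp: onorm_pos_le[OF bounded_linear_uop])
qed

text \<open>If the algebra already has a unit, then \<open>uop\<close> is not injective and its operator norm is
  only a seminorm; the term \<open>cmod (uscal x)\<close> restores definiteness and keeps the C*-identity.\<close>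
instantiation unitization :: (cstar_algebra) real_normed_algebra_1
begin

definition norm_unitization :: "'a unitization \<Rightarrow> real" where
  "norm_unitization x = max (cmod (uscal x)) (onorm (uop x))"
definition dist_unitization :: "'a unitization \<Rightarrow> 'a unitization \<Rightarrow> real" where
  "dist_unitization x y = norm (x - y)"
definition sgn_unitization :: "'a unitization \<Rightarrow> 'a unitization" where
  "sgn_unitization x = x /\<^sub>R norm x"
definition uniformity_unitization :: "('a unitization \<times> 'a unitization) filter" where
  "uniformity_unitization = (INF e\<in>{0<..}. principal {(x, y). dist x y < e})"
definition open_unitization :: "'a unitization set \<Rightarrow> bool" where
  "open_unitization U \<longleftrightarrow> (\<forall>x\<in>U. \<forall>\<^sub>F (x', y) in uniformity. x' = x \<longrightarrow> y \<in> U)"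

instance
proof
  fix x y :: "'a unitization" and r :: real
  show "dist x y = norm (x - y)" by (rule dist_unitization_def)
  show "sgn x = x /\<^sub>R norm x" by (rule sgn_unitization_def)
  show "(uniformity :: ('a unitization \<times> 'a unitization) filter)
      = (INF e\<in>{0<..}. principal {(x, y). dist x y < e})"
    by (rule uniformity_unitization_def)
  show "open U \<longleftrightarrow> (\<forall>x\<in>U. \<forall>\<^sub>F (x', y) in uniformity. x' = x \<longrightarrow> y \<in> U)"
    for U :: "'a unitization set"
    by (rule open_unitization_def)
  show "norm x = 0 \<longleftrightarrow> x = 0"
  proof
    assume "norm x = 0"
    then have "uscal x = 0" and o: "onorm (uop x) = 0"
      using onorm_pos_le[OF bounded_linear_uop, of x]
      by (auto simp: norm_unitization_def max_def split: if_splits)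
    then have "x = Unitization 0 (uelem x)" by (simp add: unitization.expand)
    then have "norm (uelem x) = 0" using o onorm_uop_elem by metis
    with \<open>uscal x = 0\<close> show "x = 0" by (simp add: unitization_defs unitization.expand)
  next
    assume "x = 0"
    then show "norm x = 0"
      using onorm_uop_elem[of "0::'a"] by (simp add: norm_unitization_def unitization_defs)
  qed
  have "onorm (uop (x + y)) \<le> onorm (uop x) + onorm (uop y)"
    unfolding uop_add by (rule onorm_triangle[OF bounded_linear_uop bounded_linear_uop])
  then show "norm (x + y) \<le> norm x + norm y"
    using norm_triangle_ineq[of "uscal x" "uscal y"]
    by (auto simp: norm_unitization_def plus_unitization_def)
  show "norm (r *\<^sub>R x) = \<bar>r\<bar> * norm x"
    unfolding scaleR_scaleC
    by (simp add: norm_unitization_def onorm_uop_scaleC)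
      (simp add: scaleC_unitization_def norm_mult max_mult_distrib_left)
  have "onorm (uop (x * y)) \<le> onorm (uop x) * onorm (uop y)"
    unfolding uop_mult by (rule onorm_compose[OF bounded_linear_uop bounded_linear_uop])
  also have "\<dots> \<le> norm x * norm y"
    by (intro mult_mono) (auto simp: norm_unitization_def le_max_iff_disj onorm_pos_le[OF bounded_linear_uop])
  finally have "onorm (uop (x * y)) \<le> norm x * norm y" .
  moreover have "cmod (uscal (x * y)) \<le> norm x * norm y"
    by (auto simp: norm_unitization_def times_unitization_def norm_mult le_max_iff_disj intro!: mult_mono)
  ultimately show "norm (x * y) \<le> norm x * norm y"
    by (subst norm_unitization_def) simp
  have "onorm (uop (1::'a unitization)) \<le> 1"
    by (rule onorm_bound) (simp_all add: uop_def one_unitization_def scaleC_one)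
  then show "norm (1::'a unitization) = 1"
    by (simp add: norm_unitization_def) (simp add: one_unitization_def)
qed

end

lemma norm_Unitization_zero: "norm (Unitization 0 a) = norm (a::'a::cstar_algebra)"
  by (simp add: norm_unitization_def onorm_uop_elem)

lemma norm_scaleC_unitization: "norm (c *\<^sub>C x) = cmod c * norm (x::'a::cstar_algebra unitization)"
  by (simp add: norm_unitization_def onorm_uop_scaleC)
    (simp add: scaleC_unitization_def norm_mult max_mult_distrib_left)

lemma unitization_decompose: "x = uscal x *\<^sub>C 1 + Unitization 0 (uelem x)"
  by (simp add: unitization_defs scaleC_unitization_def unitization.expand)

lemma norm_unitization_le: "norm x \<le> cmod (uscal x) + norm (uelem (x::'a::cstar_algebra unitization))"
  using norm_triangle_ineq[of "uscal x *\<^sub>C 1" "Unitization 0 (uelem x)"]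
  by (simp add: norm_Unitization_zero norm_scaleC_unitization unitization_decompose[symmetric])

lemma cmod_uscal_le: "cmod (uscal x) \<le> norm (x::'a::cstar_algebra unitization)"
  by (simp add: norm_unitization_def)

text \<open>Removing the scalar part costs at most another \<open>norm x\<close>. With
  \<open>cmod_uscal_le\<close> and \<open>norm_unitization_le\<close> the norm is equivalent to the
  sum of the component norms, so completeness can be checked by components.\<close>

lemma norm_uelem_le: "norm (uelem x) \<le> 2 * norm (x::'a::cstar_algebra unitization)"
proof -
  have "Unitization 0 (uelem x) = x - uscal x *\<^sub>C 1"
    by (subst (2) unitization_decompose) simp
  then have "norm (uelem x) = norm (x - uscal x *\<^sub>C 1)"
    by (metis norm_Unitization_zero)
  also have "\<dots> \<le> norm x + cmod (uscal x)"
    using norm_triangle_ineq4[of x "uscal x *\<^sub>C 1"] by (simp add: norm_scaleC_unitization)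
  finally show ?thesis using cmod_uscal_le[of x] by simp
qed

instance unitization :: (cstar_algebra) banach
proof
  fix X :: "nat \<Rightarrow> 'a unitization"
  assume X: "Cauchy X"
  have "Cauchy (\<lambda>n. uscal (X n))"
    unfolding Cauchy_iff
  proof (intro allI impI)
    fix e :: real assume "0 < e"
    then obtain M where M: "\<forall>m\<ge>M. \<forall>n\<ge>M. norm (X m - X n) < e" using X unfolding Cauchy_iff by blast
    have "norm (uscal (X m) - uscal (X n)) < e" if "m \<ge> M" "n \<ge> M" for m n
    proof -
      have "norm (X m - X n) < e" using M that by blast
      then show ?thesis using cmod_uscal_le[of "X m - X n"] by (simp add: minus_unitization_def)
    qed
    then show "\<exists>M. \<forall>m\<ge>M. \<forall>n\<ge>M. norm (uscal (X m) - uscal (X n)) < e" by blast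
  qed
  then obtain c where c: "(\<lambda>n. uscal (X n)) \<longlonglongrightarrow> c"
    using Cauchy_convergent convergent_def by blast
  have "Cauchy (\<lambda>n. uelem (X n))"
    unfolding Cauchy_iff
  proof (intro allI impI)
    fix e :: real assume "0 < e"
    then have "0 < e / 2" by simp
    then obtain M where M: "\<forall>m\<ge>M. \<forall>n\<ge>M. norm (X m - X n) < e / 2" using X unfolding Cauchy_iff by blast
    have "norm (uelem (X m) - uelem (X n)) < e" if "m \<ge> M" "n \<ge> M" for m n
    proof -
      have "norm (X m - X n) < e / 2" using M that by blast
      then show ?thesis using norm_uelem_le[of "X m - X n"] by (simp add: minus_unitization_def)
    qed
    then show "\<exists>M. \<forall>m\<ge>M. \<forall>n\<ge>M. norm (uelem (X m) - uelem (X n)) < e" by blast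
  qed
  then obtain a where a: "(\<lambda>n. uelem (X n)) \<longlonglongrightarrow> a"
    using Cauchy_convergent convergent_def by blast
  have lim: "(\<lambda>n. cmod (uscal (X n) - c) + norm (uelem (X n) - a)) \<longlonglongrightarrow> 0"
    using tendsto_add[OF tendsto_norm_zero[OF LIM_zero[OF c]] tendsto_norm_zero[OF LIM_zero[OF a]]] by simp
  have le: "norm (X n - Unitization c a) \<le> cmod (uscal (X n) - c) + norm (uelem (X n) - a)" for n
    using norm_unitization_le[of "X n - Unitization c a"] by (simp add: minus_unitization_def)
  have "(\<lambda>n. X n - Unitization c a) \<longlonglongrightarrow> 0"
    by (rule tendsto_0_le[OF lim, where K = 1])
      (intro always_eventually allI order_trans[OF le], simp)
  then show "convergent X" unfolding convergent_def using LIM_zero_cancel by blast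
qed

instantiation unitization :: (cstar_algebra) cstar_algebra
begin

definition cstar_unitization :: "'a unitization \<Rightarrow> 'a unitization" where
  "cstar_unitization x = Unitization (cnj (uscal x)) (cstar (uelem x))"

instance
proof
  fix x y :: "'a unitization" and c :: complex
  show "norm (c *\<^sub>C x) = cmod c * norm x" by (rule norm_scaleC_unitization)
  show "c *\<^sub>C x * y = c *\<^sub>C (x * y)" "x * c *\<^sub>C y = c *\<^sub>C (x * y)"
    by (simp_all add: times_unitization_def scaleC_unitization_def scaleC_add_right scaleC_scaleC
        mult_scaleC_left mult_scaleC_right mult_ac)
  show cc: "cstar (cstar x) = x" for x :: "'a unitization"
    by (simp add: cstar_unitization_def cstar_cstar)
  show "cstar (x + y) = cstar x + cstar y"
    by (simp add: cstar_unitization_def plus_unitization_def cstar_add)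
  show "cstar (c *\<^sub>C x) = cnj c *\<^sub>C cstar x"
    by (simp add: cstar_unitization_def scaleC_unitization_def cstar_scaleC)
  show "cstar (x * y) = cstar y * cstar x"
    by (simp add: cstar_unitization_def times_unitization_def cstar_add cstar_mult cstar_scaleC
        algebra_simps)
  \<comment> \<open>The argument for Hilbert space operators, with \<open>cstar v * w\<close> in
    place of the inner product of \<open>v\<close> and \<open>w\<close>.\<close>
  have sq: "(onorm (uop x))\<^sup>2 \<le> onorm (uop (cstar x * x))" for x :: "'a unitization"
  proof -
    let ?K = "onorm (uop (cstar x * x))"
    have K: "0 \<le> ?K" by (rule onorm_pos_le[OF bounded_linear_uop])
    have "norm (uop x v) \<le> sqrt ?K * norm v" for v
    proof -
      have adj: "cstar (uop x v) * uop x v = cstar v * uop (cstar x * x) v"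
        by (simp add: uop_mult) (simp add: uop_def cstar_unitization_def cstar_add cstar_mult cstar_scaleC
            mult_scaleC_left mult_scaleC_right scaleC_add_right scaleC_scaleC algebra_simps)
      have "(norm (uop x v))\<^sup>2 = norm (cstar v * uop (cstar x * x) v)"
        by (simp only: cstar_identity[symmetric] adj)
      also have "\<dots> \<le> norm v * (?K * norm v)"
        using norm_mult_ineq[of "cstar v" "uop (cstar x * x) v"]
          mult_left_mono[OF onorm[OF bounded_linear_uop, of "cstar x * x" v] norm_ge_zero[of v]] by simp
      also have "\<dots> = (sqrt ?K * norm v)\<^sup>2" using K by (simp add: power_mult_distrib power2_eq_square)
      finally show ?thesis by (rule power2_le_imp_le) (use K in simp)
    qed
    then have "onorm (uop x) \<le> sqrt ?K" using K by (intro onorm_bound) auto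
    then have "(onorm (uop x))\<^sup>2 \<le> (sqrt ?K)\<^sup>2"
      by (intro power_mono onorm_pos_le[OF bounded_linear_uop])
    then show ?thesis using K by simp
  qed
  have prod: "onorm (uop (cstar x * x)) \<le> onorm (uop (cstar x)) * onorm (uop x)" for x :: "'a unitization"
    unfolding uop_mult by (rule onorm_compose[OF bounded_linear_uop bounded_linear_uop])
  have le: "onorm (uop x) \<le> onorm (uop (cstar x))" for x :: "'a unitization"
  proof (cases "onorm (uop x) = 0")
    case True
    then show ?thesis using onorm_pos_le[OF bounded_linear_uop] by simp
  next
    case False
    then have pos: "0 < onorm (uop x)" using onorm_pos_le[OF bounded_linear_uop, of x] by simp
    have "onorm (uop x) * onorm (uop x) \<le> onorm (uop (cstar x)) * onorm (uop x)"
      using sq[of x] prod[of x] by (simp add: power2_eq_square)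
    then show ?thesis using pos by simp
  qed
  have "onorm (uop (cstar x)) = onorm (uop x)"
    using le[of x] le[of "cstar x"] by (simp add: cc)
  then have op: "onorm (uop (cstar x * x)) = (onorm (uop x))\<^sup>2"
    using sq[of x] prod[of x] by (simp add: power2_eq_square)
  \<comment> \<open>Both entries of the maximum satisfy the C*-identity, hence so does the
    maximum.\<close>
  have "cmod (uscal (cstar x * x)) = (cmod (uscal x))\<^sup>2"
    by (simp add: times_unitization_def cstar_unitization_def norm_mult power2_eq_square)
  then show "norm (cstar x * x) = (norm x)\<^sup>2"
    using onorm_pos_le[OF bounded_linear_uop, of x]
    by (cases "cmod (uscal x) \<le> onorm (uop x)")
      (simp_all add: norm_unitization_def op max_absorb1 max_absorb2 power_mono)
qed

end

text \<open>The embedding \<open>Unitization 0\<close> is additive and isometric and keeps the form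
  \<open>cstar d * d\<close>, so the unital case applies.\<close>

theorem norm_cstar_positive_mono:
  fixes a b :: "'a::cstar_algebra"
  assumes "cstar_positive a" "cstar_positive b"
  shows "norm a \<le> norm (a + b)"
proof -
  have psd: "psd (Unitization 0 c)" if "cstar_positive c" for c :: 'a
  proof -
    from that obtain d where "c = cstar d * d" unfolding cstar_positive_def by blast
    then have "Unitization 0 c = cstar (Unitization 0 d) * Unitization 0 d"
      by (simp add: times_unitization_def cstar_unitization_def)
    then show ?thesis by (simp add: psd_cstar_mult_self)
  qed
  have "Unitization 0 a + Unitization 0 b = Unitization 0 (a + b)"
    by (simp add: plus_unitization_def)
  then show ?thesis
    using norm_psd_mono[OF psd[OF assms(1)] psd[OF assms(2)]] by (simp add: norm_Unitization_zero)
qed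

section \<open>Hilbert modules\<close>

locale cstar_hilbert_module =
  fixes act :: "'a::cstar_algebra \<Rightarrow> 'm::complex_vector \<Rightarrow> 'm" and ip :: "'m \<Rightarrow> 'm \<Rightarrow> 'a"
  assumes hilbert_module: "hilbert_module act ip"
begin

lemma act_add_right: "act a (x + y) = act a x + act a y"
  and act_add_left: "act (a + b) x = act a x + act b x"
  and act_scaleC_left: "act (c *\<^sub>C a) x = c *\<^sub>C act a x"
  and act_scaleC_right: "act a (c *\<^sub>C x) = c *\<^sub>C act a x"
  and ip_add_left: "ip (x + y) z = ip x z + ip y z"
  and ip_scaleC_left: "ip (c *\<^sub>C x) y = c *\<^sub>C ip x y"
  and ip_act_left: "ip (act a x) y = a * ip x y"
  and cstar_ip: "cstar (ip x y) = ip y x"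
  and ip_positive: "cstar_positive (ip x x)"
  and ip_self_eq_zero: "ip x x = 0 \<longleftrightarrow> x = 0"
  and complete: "(\<And>e. e > 0 \<Longrightarrow> \<exists>N. \<forall>m\<ge>N. \<forall>n\<ge>N. hnorm ip (X m - X n) < e) \<Longrightarrow>
        \<exists>l. (\<lambda>n. hnorm ip (X n - l)) \<longlonglongrightarrow> 0"
  using hilbert_module unfolding hilbert_module_def by auto

lemma ip_add_right: "ip x (y + z) = ip x y + ip x z"
  by (metis cstar_ip ip_add_left cstar_add)

lemma ip_scaleC_right: "ip x (c *\<^sub>C y) = cnj c *\<^sub>C ip x y"
  by (metis cstar_ip ip_scaleC_left cstar_scaleC)

lemma ip_act_right: "ip x (act a y) = ip x y * cstar a"
  by (metis cstar_ip ip_act_left cstar_mult)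

lemma ip_minus_left: "ip (- x) y = - ip x y"
  using ip_scaleC_left[of "-1" x y] by (simp add: scaleC_minus_left scaleC_one)

lemma ip_diff_left: "ip (x - y) z = ip x z - ip y z"
  using ip_add_left[of x "- y" z] by (simp add: ip_minus_left)

lemma ip_minus_right: "ip x (- y) = - ip x y"
  by (metis cstar_ip ip_minus_left cstar_minus)

lemma ip_diff_right: "ip x (y - z) = ip x y - ip x z"
  using ip_add_right[of x y "- z"] by (simp add: ip_minus_right)

lemma act_minus_left: "act (- a) x = - act a x"
  using act_scaleC_left[of "-1" a x] by (simp add: scaleC_minus_left scaleC_one)

lemma act_diff_left: "act (a - b) x = act a x - act b x"
  using act_add_left[of a "- b" x] by (simp add: act_minus_left)

lemma act_diff_right: "act a (x - y) = act a x - act a y"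
  using act_add_right[of a x "(-1) *\<^sub>C y"]
  by (simp only: act_scaleC_right) (simp add: scaleC_minus_left scaleC_one)

lemma ip_scaleR: "ip (r *\<^sub>R x) y = r *\<^sub>R ip x y" "ip x (r *\<^sub>R y) = r *\<^sub>R ip x y"
  by (simp_all add: scaleR_scaleC ip_scaleC_left ip_scaleC_right)

lemma act_scaleR: "act (r *\<^sub>R a) x = r *\<^sub>R act a x" "act a (r *\<^sub>R x) = r *\<^sub>R act a x"
  by (simp_all add: scaleR_scaleC act_scaleC_left act_scaleC_right)

section \<open>The module norm and its estimates\<close>

lemma hnorm_nonneg [simp]: "0 \<le> hnorm ip x"
  by (simp add: hnorm_def)

lemma hnorm_square: "(hnorm ip x)\<^sup>2 = norm (ip x x)"
  by (simp add: hnorm_def)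

lemma hnorm_eq_zero [simp]: "hnorm ip x = 0 \<longleftrightarrow> x = 0"
  by (simp add: hnorm_def ip_self_eq_zero)

lemma hnorm_zero [simp]: "hnorm ip 0 = 0"
  by simp

lemma hnorm_scaleC: "hnorm ip (c *\<^sub>C x) = cmod c * hnorm ip x"
proof -
  have "ip (c *\<^sub>C x) (c *\<^sub>C x) = (c * cnj c) *\<^sub>C ip x x"
    by (simp add: ip_scaleC_left ip_scaleC_right scaleC_scaleC mult.commute)
  then have "norm (ip (c *\<^sub>C x) (c *\<^sub>C x)) = (cmod c)\<^sup>2 * norm (ip x x)"
    by (simp add: norm_scaleC norm_mult power2_eq_square)
  then show ?thesis by (simp add: hnorm_def real_sqrt_mult)
qed

lemma hnorm_scaleR: "hnorm ip (r *\<^sub>R x) = \<bar>r\<bar> * hnorm ip x"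
  by (simp add: scaleR_scaleC hnorm_scaleC)

lemma hnorm_minus_commute: "hnorm ip (x - y) = hnorm ip (y - x)"
  using hnorm_scaleR[of "-1" "x - y"] by simp

text \<open>No Cauchy--Schwarz is needed: for \<open>t > 0\<close> the element
  \<open>(1 + t) \<langle>x, x\<rangle> + (1 + 1/t) \<langle>y, y\<rangle> - \<langle>x + y, x + y\<rangle>\<close> is the square of
  \<open>sqrt t x - y / sqrt t\<close>, and \<open>t = \<parallel>y\<parallel> / \<parallel>x\<parallel>\<close> is optimal.\<close>
lemma hnorm_triangle: "hnorm ip (x + y) \<le> hnorm ip x + hnorm ip y"
proof (cases "x = 0 \<or> y = 0")
  case False
  let ?a = "hnorm ip x" and ?b = "hnorm ip y"
  have "?a > 0" "?b > 0" using False by (simp_all add: less_le)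
  define t where "t = ?b / ?a"
  have t: "t > 0" using \<open>?a > 0\<close> \<open>?b > 0\<close> by (simp add: t_def)
  define z where "z = sqrt t *\<^sub>R x - (1 / sqrt t) *\<^sub>R y"
  have z: "ip z z = t *\<^sub>R ip x x + (1 / t) *\<^sub>R ip y y - ip x y - ip y x"
    using t unfolding z_def
    by (simp add: ip_diff_left ip_diff_right ip_scaleR algebra_simps)
  have "ip (x + y) (x + y) + ip z z = (1 + t) *\<^sub>R ip x x + (1 + 1 / t) *\<^sub>R ip y y"
    unfolding z by (simp add: ip_add_left ip_add_right algebra_simps)
  then have "norm (ip (x + y) (x + y)) \<le> norm ((1 + t) *\<^sub>R ip x x + (1 + 1 / t) *\<^sub>R ip y y)"
    using norm_cstar_positive_mono[OF ip_positive ip_positive, of "x + y" z] by simp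
  also have "\<dots> \<le> (1 + t) * ?a\<^sup>2 + (1 + 1 / t) * ?b\<^sup>2"
    using norm_triangle_ineq[of "(1 + t) *\<^sub>R ip x x" "(1 + 1 / t) *\<^sub>R ip y y"] t
    by (simp add: hnorm_square)
  also have "\<dots> = (?a + ?b)\<^sup>2"
    using \<open>?a > 0\<close> \<open>?b > 0\<close> by (simp add: t_def field_simps power2_eq_square)
  finally have "(hnorm ip (x + y))\<^sup>2 \<le> (?a + ?b)\<^sup>2" by (simp add: hnorm_square)
  then show ?thesis by (rule power2_le_imp_le) simp
qed auto

lemma hnorm_triangle_diff: "hnorm ip (x - z) \<le> hnorm ip (x - y) + hnorm ip (y - z)"
  using hnorm_triangle[of "x - y" "y - z"] by simp

lemma hnorm_act_le: "hnorm ip (act a x) \<le> norm a * hnorm ip x"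
proof -
  have "norm (ip (act a x) (act a x)) = norm (a * ip x x * cstar a)"
    by (simp add: ip_act_left ip_act_right mult.assoc)
  also have "\<dots> \<le> norm a * norm (ip x x) * norm a"
    by (metis norm_mult_ineq norm_cstar mult_right_mono norm_ge_zero order_trans)
  also have "\<dots> = (norm a * hnorm ip x)\<^sup>2"
    by (simp only: power_mult_distrib hnorm_square) (simp add: power2_eq_square)
  finally have "(hnorm ip (act a x))\<^sup>2 \<le> (norm a * hnorm ip x)\<^sup>2" by (simp add: hnorm_square)
  then show ?thesis by (rule power2_le_imp_le) simp
qed

text \<open>By polarization; the constant is not optimal.\<close>
lemma norm_ip_le: "norm (ip x y) \<le> 4 * (hnorm ip x * hnorm ip y)"
proof (cases "x = 0 \<or> y = 0")
  case True
  then show ?thesis using ip_scaleR(1)[of 0 x y] ip_scaleR(2)[of x 0 y] by auto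
next
  case False
  \<comment> \<open>After normalization every polarization term is the square of a norm that is at
    most \<open>1 + 1\<close>.\<close>
  have unit: "norm (ip u v) \<le> 4" if "hnorm ip u = 1" "hnorm ip v = 1" for u v
  proof -
    have term_le: "norm (ip (u + c *\<^sub>C v) (u + c *\<^sub>C v)) \<le> 4" if "cmod c = 1" for c
    proof -
      have "hnorm ip (u + c *\<^sub>C v) \<le> 2"
        using hnorm_triangle[of u "c *\<^sub>C v"] \<open>hnorm ip u = 1\<close> \<open>hnorm ip v = 1\<close> that
        by (simp add: hnorm_scaleC)
      then have "(hnorm ip (u + c *\<^sub>C v))\<^sup>2 \<le> 2\<^sup>2" by (intro power_mono) auto
      then show ?thesis by (simp add: hnorm_square)
    qed
    define Q where "Q c = ip (u + c *\<^sub>C v) (u + c *\<^sub>C v)" for c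
    have Q: "Q c = ip u u + cnj c *\<^sub>C ip u v + c *\<^sub>C ip v u + (c * cnj c) *\<^sub>C ip v v" for c
      by (simp add: Q_def ip_add_left ip_add_right ip_scaleC_left ip_scaleC_right scaleC_scaleC
          scaleC_add_right mult.commute algebra_simps)
    have four: "4 *\<^sub>R ip u v = ip u v + ip u v + (ip u v + ip u v)"
      using scaleR_left_distrib[of 2 2 "ip u v"] by (simp add: scaleR_2)
    \<comment> \<open>This sums \<open>c\<close> times \<open>Q c\<close> over the fourth roots of
      unity. There \<open>c\<close> and \<open>c * c\<close> sum to zero while
      \<open>c * cnj c = 1\<close>, so only \<open>ip u v\<close> is left.\<close>
    have "4 *\<^sub>R ip u v = Q 1 - Q (- 1) + \<i> *\<^sub>C Q \<i> - \<i> *\<^sub>C Q (- \<i>)"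
      unfolding Q four
      by (simp add: scaleC_one scaleC_minus_left scaleC_minus_right scaleC_diff_right scaleC_add_right
          scaleC_scaleC)
    also have "norm \<dots> \<le> norm (Q 1) + norm (Q (- 1)) + norm (\<i> *\<^sub>C Q \<i>) + norm (\<i> *\<^sub>C Q (- \<i>))"
      by (meson norm_triangle_ineq norm_triangle_ineq4 add_right_mono order_trans)
    also have "\<dots> \<le> 4 + 4 + 4 + 4"
      using term_le by (intro add_mono) (simp_all add: Q_def norm_scaleC)
    finally show ?thesis by simp
  qed
  let ?a = "hnorm ip x" and ?b = "hnorm ip y"
  have pos: "?a > 0" "?b > 0" using False by (simp_all add: less_le)
  have "norm (ip ((1 / ?a) *\<^sub>R x) ((1 / ?b) *\<^sub>R y)) \<le> 4"
    using pos False by (intro unit) (simp_all add: hnorm_scaleR)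
  then show ?thesis using pos by (simp add: ip_scaleR field_simps)
qed

section \<open>Convergence in the module norm, which \<open>ip\<close> induces on a type without
  topology\<close>

definition tends :: "(nat \<Rightarrow> 'm) \<Rightarrow> 'm \<Rightarrow> bool" where
  "tends X l \<longleftrightarrow> (\<lambda>n. hnorm ip (X n - l)) \<longlonglongrightarrow> 0"

lemma tendsI:
  assumes "\<And>n. hnorm ip (X n - l) \<le> r n" "r \<longlonglongrightarrow> 0"
  shows "tends X l"
  unfolding tends_def by (rule tendsto_sandwich[OF _ _ tendsto_const assms(2)]) (use assms(1) in auto)

lemma tends_unique:
  assumes "tends X l" "tends X l'" shows "l = l'"
proof -
  have "(\<lambda>n. hnorm ip (X n - l) + hnorm ip (X n - l')) \<longlonglongrightarrow> 0"
    using tendsto_add[OF assms[unfolded tends_def]] by simp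
  moreover have "hnorm ip (l - l') \<le> hnorm ip (X n - l) + hnorm ip (X n - l')" for n
    using hnorm_triangle_diff[of l l' "X n"] by (simp add: hnorm_minus_commute)
  ultimately have "hnorm ip (l - l') \<le> 0" by (intro LIMSEQ_le_const) auto
  then show ?thesis using hnorm_nonneg[of "l - l'"] by (simp add: order_antisym)
qed

lemma tends_add:
  assumes "tends X l" "tends Y k" shows "tends (\<lambda>n. X n + Y n) (l + k)"
proof (rule tendsI)
  show "hnorm ip (X n + Y n - (l + k)) \<le> hnorm ip (X n - l) + hnorm ip (Y n - k)" for n
    using hnorm_triangle[of "X n - l" "Y n - k"] by (simp add: algebra_simps)
  show "(\<lambda>n. hnorm ip (X n - l) + hnorm ip (Y n - k)) \<longlonglongrightarrow> 0"
    using tendsto_add[OF assms[unfolded tends_def]] by simp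
qed

lemma tends_scaleC:
  assumes "tends X l" shows "tends (\<lambda>n. c *\<^sub>C X n) (c *\<^sub>C l)"
proof (rule tendsI)
  show "hnorm ip (c *\<^sub>C X n - c *\<^sub>C l) \<le> cmod c * hnorm ip (X n - l)" for n
    by (simp add: scaleC_diff_right[symmetric] hnorm_scaleC)
  show "(\<lambda>n. cmod c * hnorm ip (X n - l)) \<longlonglongrightarrow> 0"
    using tendsto_mult[OF tendsto_const assms[unfolded tends_def], of "cmod c"] by simp
qed

lemma tends_subseq: "tends X l \<Longrightarrow> strict_mono r \<Longrightarrow> tends (\<lambda>n. X (r n)) l"
  unfolding tends_def using LIMSEQ_subseq_LIMSEQ[of "\<lambda>n. hnorm ip (X n - l)" 0 r] by (simp add: o_def)

text \<open>This turns approximate identities of \<open>f\<close>, rescaled so that their defects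
  vanish, into exact identities for the limit.\<close>

lemma tends_close:
  assumes "tends X l" "\<And>n. hnorm ip (Y n - X n) \<le> r n" "r \<longlonglongrightarrow> 0"
  shows "tends Y l"
proof (rule tendsI)
  show "hnorm ip (Y n - l) \<le> r n + hnorm ip (X n - l)" for n
    using hnorm_triangle_diff[of "Y n" l "X n"] assms(2)[of n] by simp
  show "(\<lambda>n. r n + hnorm ip (X n - l)) \<longlonglongrightarrow> 0"
    using tendsto_add[OF assms(3) assms(1)[unfolded tends_def]] by simp
qed

lemma tends_hnorm:
  assumes "tends X l" shows "(\<lambda>n. hnorm ip (X n)) \<longlonglongrightarrow> hnorm ip l"
proof (rule LIM_zero_cancel, rule tendsto_0_le[where K = 1])
  show "(\<lambda>n. hnorm ip (X n - l)) \<longlonglongrightarrow> 0" using assms by (simp add: tends_def)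
  have "\<bar>hnorm ip (X n) - hnorm ip l\<bar> \<le> hnorm ip (X n - l)" for n
    using hnorm_triangle[of "X n - l" l] hnorm_triangle[of "l - X n" "X n"] hnorm_minus_commute[of l "X n"]
    by simp
  then show "\<forall>\<^sub>F n in sequentially. norm (hnorm ip (X n) - hnorm ip l) \<le> norm (hnorm ip (X n - l)) * 1"
    by simp
qed

lemma tendsto_ip:
  assumes "tends X x" "tends Y y"
  shows "(\<lambda>n. ip (X n) (Y n)) \<longlonglongrightarrow> ip x y"
proof (rule LIM_zero_cancel, rule tendsto_0_le[where K = 1])
  let ?r = "\<lambda>n. 4 * (hnorm ip (X n - x) * hnorm ip (Y n)) + 4 * (hnorm ip x * hnorm ip (Y n - y))"
  have "?r \<longlonglongrightarrow> 4 * (0 * hnorm ip y) + 4 * (hnorm ip x * 0)"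
    by (intro tendsto_intros tends_hnorm assms assms[unfolded tends_def])
  then show "?r \<longlonglongrightarrow> 0" by simp
  have "norm (ip (X n) (Y n) - ip x y) \<le> ?r n" for n
  proof -
    have "ip (X n) (Y n) - ip x y = ip (X n - x) (Y n) + ip x (Y n - y)"
      by (simp add: ip_diff_left ip_diff_right)
    then show ?thesis
      using norm_triangle_ineq[of "ip (X n - x) (Y n)" "ip x (Y n - y)"]
        norm_ip_le[of "X n - x" "Y n"] norm_ip_le[of x "Y n - y"] by simp
  qed
  then show "\<forall>\<^sub>F n in sequentially. norm (ip (X n) (Y n) - ip x y) \<le> norm (?r n) * 1"
    by (intro always_eventually allI) (simp add: order_trans[OF _ abs_ge_self])
qed

lemma tends_act:
  assumes "a \<longlonglongrightarrow> b" "tends X x"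
  shows "tends (\<lambda>n. act (a n) (X n)) (act b x)"
proof (rule tendsI)
  show "hnorm ip (act (a n) (X n) - act b x) \<le> norm (a n - b) * hnorm ip (X n) + norm b * hnorm ip (X n - x)" for n
  proof -
    have "act (a n) (X n) - act b x = act (a n - b) (X n) + act b (X n - x)"
      by (simp add: act_diff_left act_diff_right)
    then show ?thesis
      using hnorm_triangle[of "act (a n - b) (X n)" "act b (X n - x)"]
        hnorm_act_le[of "a n - b" "X n"] hnorm_act_le[of b "X n - x"] by simp
  qed
  have "(\<lambda>n. norm (a n - b) * hnorm ip (X n) + norm b * hnorm ip (X n - x))
      \<longlonglongrightarrow> 0 * hnorm ip x + norm b * 0"
    by (intro tendsto_intros tends_hnorm assms assms(2)[unfolded tends_def]
        tendsto_norm_zero LIM_zero)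
  then show "(\<lambda>n. norm (a n - b) * hnorm ip (X n) + norm b * hnorm ip (X n - x)) \<longlonglongrightarrow> 0" by simp
qed

text \<open>Telescoping and the geometric sum. Uniformity in \<open>k\<close> gives the Cauchy
  property, and \<open>n = 0\<close> the distance from \<open>X 0\<close> to the limit.\<close>

lemma hnorm_diff_le_geometric:
  assumes "\<And>n. hnorm ip (X (Suc n) - X n) \<le> C * L ^ n" "0 \<le> C" "0 \<le> L" "L < 1"
  shows "hnorm ip (X (n + k) - X n) \<le> L ^ n * (C / (1 - L))"
proof -
  have "hnorm ip (X (n + k) - X n) \<le> (\<Sum>j<k. C * L ^ (n + j))"
  proof (induction k)
    case (Suc k)
    then show ?case
      using hnorm_triangle_diff[of "X (n + Suc k)" "X n" "X (n + k)"] assms(1)[of "n + k"] by simp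
  qed simp
  also have "\<dots> = L ^ n * (C * (\<Sum>j<k. L ^ j))"
    by (simp add: sum_distrib_left power_add mult_ac)
  also have "(\<Sum>j<k. L ^ j) \<le> 1 / (1 - L)"
    using assms(3,4) mult_left_le_one_le[of "L ^ k" L] by (simp add: sum_gp_strict field_simps)
  finally show ?thesis using assms(2,3) by (simp add: mult_left_mono)
qed

lemma geometric_tends:
  assumes step: "\<And>n. hnorm ip (X (Suc n) - X n) \<le> C * L ^ n" and C: "0 \<le> C" and L: "0 \<le> L" "L < 1"
  obtains l where "tends X l" "hnorm ip (X 0 - l) \<le> C / (1 - L)"
proof -
  note bound = hnorm_diff_le_geometric[OF step C L]
  have "\<exists>N. \<forall>m\<ge>N. \<forall>n\<ge>N. hnorm ip (X m - X n) < e" if "e > 0" for e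
  proof -
    \<comment> \<open>Twice the tail bound, since \<open>X m\<close> and \<open>X n\<close> are both
      compared with \<open>X N\<close>.\<close>
    have "(\<lambda>n. L ^ n * (C / (1 - L)) + L ^ n * (C / (1 - L))) \<longlonglongrightarrow> 0 * (C / (1 - L)) + 0 * (C / (1 - L))"
      by (intro tendsto_add tendsto_mult tendsto_const LIMSEQ_realpow_zero L)
    then have "\<forall>\<^sub>F n in sequentially. L ^ n * (C / (1 - L)) + L ^ n * (C / (1 - L)) < e"
      by (rule order_tendstoD(2)) (use that in simp)
    then obtain N where N: "L ^ N * (C / (1 - L)) + L ^ N * (C / (1 - L)) < e"
      by (auto simp: eventually_sequentially)
    have "hnorm ip (X m - X N) \<le> L ^ N * (C / (1 - L))" if "m \<ge> N" for m
      using bound[of N "m - N"] that by simp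
    then have "hnorm ip (X m - X n) < e" if "m \<ge> N" "n \<ge> N" for m n
      using hnorm_triangle_diff[of "X m" "X n" "X N"] hnorm_minus_commute[of "X N" "X n"] that N
      by (smt (verit))
    then show ?thesis by blast
  qed
  then obtain l where l: "tends X l" using complete unfolding tends_def by blast
  have "tends (\<lambda>n. X n - X 0) (l - X 0)"
    using l by (simp add: tends_def)
  then have "(\<lambda>n. hnorm ip (X n - X 0)) \<longlonglongrightarrow> hnorm ip (l - X 0)" by (rule tends_hnorm)
  moreover have "hnorm ip (X n - X 0) \<le> C / (1 - L)" for n using bound[of 0 n] by simp
  ultimately have "hnorm ip (l - X 0) \<le> C / (1 - L)" by (intro LIMSEQ_le_const2) auto
  then show thesis using that l by (simp add: hnorm_minus_commute)
qed

end

section \<open>From unimodular scalars to complex linearity\<close>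

lemma complex_eq_sum_of_unit:
  assumes "cmod c \<le> 2"
  obtains u v where "cmod u = 1" "cmod v = 1" "c = u + v"
proof (cases "c = 0")
  case True
  then show thesis using that[of 1 "-1"] by simp
next
  case False
  define r where "r = cmod c"
  have r: "0 < r" "r \<le> 2" using assms False by (simp_all add: r_def)
  \<comment> \<open>A unit vector with real part \<open>r / 2\<close>, so that it and its conjugate
    add to \<open>r\<close>; the factor \<open>sgn c\<close> then rotates the sum onto
    \<open>c\<close>.\<close>
  define w where "w = Complex (r / 2) (sqrt (1 - (r / 2)\<^sup>2))"
  have "(r / 2)\<^sup>2 \<le> 1" using r by (simp add: power_le_one)
  then have w: "cmod w = 1" by (simp add: w_def cmod_def)
  have "w + cnj w = of_real r" by (simp add: w_def complex_eq_iff)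
  then have "c = sgn c * w + sgn c * cnj w"
    using False by (simp add: distrib_left[symmetric] sgn_div_norm r_def scaleR_conv_of_real)
  then show thesis
    using that[of "sgn c * w" "sgn c * cnj w"] w False by (simp add: norm_mult norm_sgn)
qed

lemma complex_linear_of_unit_linear:
  fixes H :: "'m::complex_vector \<Rightarrow> 'n::complex_vector"
  assumes unit: "\<And>u x y. cmod u = 1 \<Longrightarrow> H (u *\<^sub>C x + y) = u *\<^sub>C H x + H y"
  shows "H (x + y) = H x + H y" and "H (c *\<^sub>C x) = c *\<^sub>C H x"
proof -
  have add: "H (x + y) = H x + H y" for x y using unit[of 1 x y] by (simp add: scaleC_one)
  then show "H (x + y) = H x + H y" .
  have "H 0 = 0" using add[of 0 0] by simp
  then have scale: "H (u *\<^sub>C x) = u *\<^sub>C H x" if "cmod u = 1" for u x using unit[OF that, of x 0] by simp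
  have nat: "H (of_nat k *\<^sub>C x) = of_nat k *\<^sub>C H x" for k x
    by (induction k) (simp_all add: \<open>H 0 = 0\<close> scaleC_add_left scaleC_one add)
  \<comment> \<open>Division by \<open>k\<close> brings the scalar into the range of
    \<open>complex_eq_sum_of_unit\<close>; additivity undoes the division.\<close>
  obtain k :: nat where k: "cmod c < real k" using reals_Archimedean2 by blast
  then have "k \<noteq> 0" by (metis norm_ge_zero not_le of_nat_0)
  then have "cmod (c / of_nat k) \<le> 2" using k by (simp add: norm_divide field_simps)
  then obtain u v where uv: "cmod u = 1" "cmod v = 1" "c / of_nat k = u + v"
    by (rule complex_eq_sum_of_unit)
  then have c: "c = of_nat k * (u + v)" using \<open>k \<noteq> 0\<close> by (simp add: field_simps)
  have "H (c *\<^sub>C x) = of_nat k *\<^sub>C H (u *\<^sub>C x + v *\<^sub>C x)"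
    by (simp only: c scaleC_scaleC[symmetric] nat scaleC_add_left)
  also have "\<dots> = c *\<^sub>C H x"
    by (simp add: add scale uv c scaleC_scaleC[symmetric] scaleC_add_left)
  finally show "H (c *\<^sub>C x) = c *\<^sub>C H x" .
qed

section \<open>Stability of homomorphisms\<close>

theorem theorem3p1:
  fixes actA :: "'a::cstar_algebra \<Rightarrow> 'm::complex_vector \<Rightarrow> 'm"
    and ipA :: "'m \<Rightarrow> 'm \<Rightarrow> 'a"
    and actB :: "'b::cstar_algebra \<Rightarrow> 'n::complex_vector \<Rightarrow> 'n"
    and ipB :: "'n \<Rightarrow> 'n \<Rightarrow> 'b"
    and f :: "'m \<Rightarrow> 'n"
    and \<phi> :: "'m \<Rightarrow> 'm \<Rightarrow> 'm \<Rightarrow> real"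
    and L :: real
  assumes HA: "hilbert_module actA ipA"
    and HB: "hilbert_module actB ipB"
    and phi_nonneg: "\<forall>x y z. 0 \<le> \<phi> x y z"
    and add_approx: "\<forall>\<mu> x y. cmod \<mu> = 1 \<longrightarrow>
           hnorm ipB (f (\<mu> *\<^sub>C x + y) - \<mu> *\<^sub>C f x - f y) \<le> \<phi> x y 0"
    and ip_approx: "\<forall>x y z.
           hnorm ipB (f (actA (ipA x y) z) - actB (ipB (f x) (f y)) (f z)) \<le> \<phi> x y z"
    and ip_star_approx: "\<forall>x y z.
           hnorm ipB (f (actA (cstar (ipA x y)) z) - actB (cstar (ipB (f x) (f y))) (f z))
             \<le> \<phi> x y z"
    and L_ge: "0 \<le> L" and L_lt: "L < 1"
    and phi_contr: "\<forall>x y z. \<phi> x y z \<le> 2 * L * \<phi> ((1/2) *\<^sub>R x) ((1/2) *\<^sub>R y) ((1/2) *\<^sub>R z)"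
  shows "\<exists>!H. hilbert_module_star_hom actA ipA actB ipB H \<and>
           (\<forall>x. hnorm ipB (f x - H x) \<le> 1 / (2 - 2 * L) * \<phi> x x 0)"
proof -
  interpret A: cstar_hilbert_module actA ipA by unfold_locales (rule HA)
  interpret B: cstar_hilbert_module actB ipB by unfold_locales (rule HB)
  define D where "D n x = 2 ^ n *\<^sub>R x" for n :: nat and x :: 'm
  define X where "X x n = (1 / 2 ^ n) *\<^sub>R f (D n x)" for x n
  have D_zero: "D n 0 = 0" for n by (simp add: D_def)
  have D_linear: "D n (c *\<^sub>C x + y) = c *\<^sub>C D n x + D n y" for n c x y
    by (simp add: D_def scaleR_add_right scaleC_scaleR)
  \<comment> \<open>Each doubling costs a factor \<open>2 * L\<close>; the division by
    \<open>2 ^ n\<close> in \<open>X\<close> will leave \<open>L ^ n\<close>.\<close>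
  have phi_D: "\<phi> (D n x) (D n y) (D n z) \<le> (2 * L) ^ n * \<phi> x y z" for n x y z
  proof (induction n)
    case (Suc n)
    have half: "(1/2) *\<^sub>R D (Suc n) v = D n v" for v by (simp add: D_def)
    have "\<phi> (D (Suc n) x) (D (Suc n) y) (D (Suc n) z) \<le> 2 * L * \<phi> (D n x) (D n y) (D n z)"
      using phi_contr[rule_format, of "D (Suc n) x" "D (Suc n) y" "D (Suc n) z"] unfolding half .
    also have "\<dots> \<le> 2 * L * ((2 * L) ^ n * \<phi> x y z)"
      using Suc L_ge by (intro mult_left_mono) auto
    finally show ?case by (simp add: mult.assoc)
  qed (simp add: D_def)
  have phi_D_scaled: "1 / 2 ^ n * \<phi> (D n x) (D n y) (D n z) \<le> L ^ n * \<phi> x y z" for n x y z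
    using phi_D[of n x y z] by (simp add: power_mult_distrib field_simps)
  have phi_lim: "(\<lambda>n. L ^ n * r) \<longlonglongrightarrow> 0" for r
    using tendsto_mult_left_zero[OF LIMSEQ_realpow_zero[OF L_ge L_lt]] .
  have step: "hnorm ipB (X x (Suc n) - X x n) \<le> \<phi> x x 0 / 2 * L ^ n" for x n
  proof -
    \<comment> \<open>Doubling is addition with unimodular scalar \<open>1\<close>, so the
      additivity estimate applies with both arguments equal to \<open>D n x\<close>.\<close>
    have "D (Suc n) x = 1 *\<^sub>C D n x + D n x"
      by (simp add: D_def scaleC_one scaleR_2[symmetric])
    then have "X x (Suc n) - X x n
        = (1 / 2 ^ Suc n) *\<^sub>R (f (1 *\<^sub>C D n x + D n x) - 1 *\<^sub>C f (D n x) - f (D n x))"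
      by (simp add: X_def scaleC_one algebra_simps flip: scaleR_2)
    then have "hnorm ipB (X x (Suc n) - X x n)
        = 1 / 2 ^ Suc n * hnorm ipB (f (1 *\<^sub>C D n x + D n x) - 1 *\<^sub>C f (D n x) - f (D n x))"
      by (simp only: B.hnorm_scaleR) simp
    \<comment> \<open>The third argument \<open>0\<close> is written as \<open>D n 0\<close> to fit
      \<open>phi_D_scaled\<close>.\<close>
    also have "\<dots> \<le> 1 / 2 ^ Suc n * \<phi> (D n x) (D n x) (D n 0)"
      unfolding D_zero using add_approx by (intro mult_left_mono) auto
    also have "\<dots> = (1 / 2 ^ n * \<phi> (D n x) (D n x) (D n 0)) / 2" by simp
    also have "\<dots> \<le> (L ^ n * \<phi> x x 0) / 2" by (rule divide_right_mono[OF phi_D_scaled]) simp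
    finally show ?thesis by (simp add: mult_ac)
  qed
  have "\<exists>l. B.tends (X x) l \<and> hnorm ipB (f x - l) \<le> 1 / (2 - 2 * L) * \<phi> x x 0" for x
  proof -
    have "0 \<le> \<phi> x x 0 / 2" using phi_nonneg by simp
    then obtain l where l: "B.tends (X x) l" "hnorm ipB (X x 0 - l) \<le> \<phi> x x 0 / 2 / (1 - L)"
      by (rule B.geometric_tends[of "X x", OF step _ L_ge L_lt])
    \<comment> \<open>The \<open>2\<close> comes from dividing by \<open>2 ^ Suc n\<close> rather
      than \<open>2 ^ n\<close> in \<open>step\<close>, and \<open>1 - L\<close> from the geometric
      sum.\<close>
    have "\<phi> x x 0 / 2 / (1 - L) = 1 / (2 - 2 * L) * \<phi> x x 0" using L_lt by (simp add: field_simps)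
    then show ?thesis using l by (auto simp: X_def D_def)
  qed
  then obtain H where H: "\<And>x. B.tends (X x) (H x)"
    and H_bound: "\<And>x. hnorm ipB (f x - H x) \<le> 1 / (2 - 2 * L) * \<phi> x x 0"
    by metis
  have unit: "H (u *\<^sub>C x + y) = u *\<^sub>C H x + H y" if "cmod u = 1" for u x y
  proof (rule B.tends_unique[OF H])
    show "B.tends (X (u *\<^sub>C x + y)) (u *\<^sub>C H x + H y)"
    proof (rule B.tends_close[OF B.tends_add[OF B.tends_scaleC[OF H] H] _ phi_lim])
      fix n
      have "X (u *\<^sub>C x + y) n - (u *\<^sub>C X x n + X y n)
          = (1 / 2 ^ n) *\<^sub>R (f (u *\<^sub>C D n x + D n y) - u *\<^sub>C f (D n x) - f (D n y))"
        by (simp add: X_def D_linear scaleC_scaleR scaleR_diff_right scaleR_add_right diff_diff_eq)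
      then have "hnorm ipB (X (u *\<^sub>C x + y) n - (u *\<^sub>C X x n + X y n))
          = 1 / 2 ^ n * hnorm ipB (f (u *\<^sub>C D n x + D n y) - u *\<^sub>C f (D n x) - f (D n y))"
        by (simp only: B.hnorm_scaleR) simp
      also have "\<dots> \<le> 1 / 2 ^ n * \<phi> (D n x) (D n y) (D n 0)"
        unfolding D_zero using add_approx that by (intro mult_left_mono) auto
      finally show "hnorm ipB (X (u *\<^sub>C x + y) n - (u *\<^sub>C X x n + X y n)) \<le> L ^ n * \<phi> x y 0"
        using phi_D_scaled[of n x y 0] by simp
    qed
  qed
  note H_linear = complex_linear_of_unit_linear[of H, OF unit]
  have H_mult: "H (actA (ipA x y) z) = actB (ipB (H x) (H y)) (H z)" for x y z
  proof (rule B.tends_unique)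
    show "B.tends (\<lambda>n. X (actA (ipA x y) z) (3 * n)) (H (actA (ipA x y) z))"
      by (rule B.tends_subseq[OF H]) (simp add: strict_mono_def)
    show "B.tends (\<lambda>n. X (actA (ipA x y) z) (3 * n)) (actB (ipB (H x) (H y)) (H z))"
    proof (rule B.tends_close[OF B.tends_act[OF B.tendsto_ip[OF H H] H] _ phi_lim])
      fix n
      have eight: "(2::real) ^ (3 * n) = 2 ^ n * 2 ^ n * 2 ^ n"
        by (simp add: power_add[symmetric])
      have "D (3 * n) (actA (ipA x y) z) = actA (ipA (D n x) (D n y)) (D n z)"
        by (simp add: D_def eight A.act_scaleR A.ip_scaleR mult.assoc)
      then have "X (actA (ipA x y) z) (3 * n) - actB (ipB (X x n) (X y n)) (X z n)
        = (1 / 2 ^ (3 * n)) *\<^sub>R (f (actA (ipA (D n x) (D n y)) (D n z))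
            - actB (ipB (f (D n x)) (f (D n y))) (f (D n z)))"
        by (simp add: X_def eight B.act_scaleR B.ip_scaleR scaleR_diff_right mult.assoc)
      then have "hnorm ipB (X (actA (ipA x y) z) (3 * n) - actB (ipB (X x n) (X y n)) (X z n))
        = 1 / 2 ^ (3 * n) * hnorm ipB (f (actA (ipA (D n x) (D n y)) (D n z))
            - actB (ipB (f (D n x)) (f (D n y))) (f (D n z)))"
        by (simp only: B.hnorm_scaleR) simp
      \<comment> \<open>Weakening \<open>1 / 8 ^ n\<close> to \<open>1 / 2 ^ n\<close> still
        suffices for \<open>phi_D_scaled\<close>.\<close>
      also have "\<dots> \<le> 1 / 2 ^ n * \<phi> (D n x) (D n y) (D n z)"
        using ip_approx phi_nonneg by (intro mult_mono) (auto simp: frac_le)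
      also have "\<dots> \<le> L ^ n * \<phi> x y z" by (rule phi_D_scaled)
      finally show "hnorm ipB (X (actA (ipA x y) z) (3 * n) - actB (ipB (X x n) (X y n)) (X z n))
        \<le> L ^ n * \<phi> x y z" .
    qed
  qed
  show ?thesis
  proof (rule ex1I[of _ H], intro conjI allI)
    show "hilbert_module_star_hom actA ipA actB ipB H"
      unfolding hilbert_module_star_hom_def hilbert_module_hom_def
      using H_linear H_mult by (simp add: A.cstar_ip B.cstar_ip)
    show "hnorm ipB (f x - H x) \<le> 1 / (2 - 2 * L) * \<phi> x x 0" for x by (rule H_bound)
  next
    fix G
    assume G: "hilbert_module_star_hom actA ipA actB ipB G \<and>
      (\<forall>x. hnorm ipB (f x - G x) \<le> 1 / (2 - 2 * L) * \<phi> x x 0)"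
    \<comment> \<open>\<open>G\<close> commutes with scaling by \<open>2 ^ n\<close>, so its bound
      at \<open>D n x\<close>, divided by \<open>2 ^ n\<close>, shows that \<open>X x\<close> also
      tends to \<open>G x\<close>.\<close>
    have "G x = H x" for x
    proof (rule B.tends_unique[OF _ H])
      show "B.tends (X x) (G x)"
      proof (rule B.tendsI[OF _ phi_lim])
        fix n
        have "G (c *\<^sub>C y) = c *\<^sub>C G y" for c y
          using G by (simp add: hilbert_module_star_hom_def hilbert_module_hom_def)
        then have "G (D n x) = 2 ^ n *\<^sub>R G x" by (simp add: D_def scaleR_scaleC)
        then have "X x n - G x = (1 / 2 ^ n) *\<^sub>R (f (D n x) - G (D n x))"
          by (simp add: X_def scaleR_diff_right)
        then have "hnorm ipB (X x n - G x) = 1 / 2 ^ n * hnorm ipB (f (D n x) - G (D n x))"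
          by (simp only: B.hnorm_scaleR) simp
        also have "\<dots> \<le> 1 / 2 ^ n * (1 / (2 - 2 * L) * \<phi> (D n x) (D n x) (D n 0))"
          using G by (intro mult_left_mono) (auto simp: D_zero)
        also have "\<dots> = 1 / (2 - 2 * L) * (1 / 2 ^ n * \<phi> (D n x) (D n x) (D n 0))" by simp
        also have "\<dots> \<le> 1 / (2 - 2 * L) * (L ^ n * \<phi> x x 0)"
          using phi_D_scaled L_lt by (intro mult_left_mono) auto
        finally show "hnorm ipB (X x n - G x) \<le> L ^ n * (1 / (2 - 2 * L) * \<phi> x x 0)"
          by (simp add: mult_ac)
      qed
    qed
    then show "G = H" by blast
  qed
qed

end
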